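(* Let $K$ be a field and let $\mathcal{P}$ be an $(\mathcal{L},\mathcal{C})$-polyomino. Suppose that $I_{\mathcal{P}}$ is prime. Then $$\mathrm{HP}_{K[\mathcal{P}]}(t)=\frac{1}{1-t}\mathrm{HP}_{K[\mathcal{P}_4]}(t)+\frac{t}{1-t}\left[\frac{\mathrm{HP}_{K[\mathcal{P}_1]}(t)}{(1-t)^{r-2}}+\frac{\mathrm{HP}_{K[\mathcal{P}_2]}(t)}{(1-t)^{s-2}}+\frac{\mathrm{HP}_{K[\mathcal{P}_3]}(t)}{(1-t)^{s+r-3}}\right].$$
   Context: Order $\mathbb{Z}^2$ componentwise. For $u=(i,j)\le v=(k,l)$ let $[u,v]=\{w\in\mathbb{Z}^2: u\le w\le v\}$; it is a proper interval if $i<k$, $j<l$, with anti-diagonal corners $(i,l),(k,j)$. A cell is a proper interval $[u,u+(1,1)]$; $V(C)$ is the set of the 4 points of the cell $C$. A polyomino is a non-empty finite collection of cells such that any two of them are joined by a sequence of its cells in which consecutive cells share an edge. For a collection $\mathcal{S}$ of cells, $V(\mathcal{S})=\bigcup_{C\in\mathcal{S}}V(C)$; a proper interval is an inner interval of $\mathcal{S}$ if all cells contained in it belong to $\mathcal{S}$; $S_{\mathcal{S}}=K[x_v:v\in V(\mathcal{S})]$ (standard graded); $I_{\mathcal{S}}$ is the ideal generated by all $x_ux_v-x_wx_z$ where $[u,v]$ is an inner interval of $\mathcal{S}$ with anti-diagonal corners $w,z$; $K[\mathcal{S}]=S_{\mathcal{S}}/I_{\mathcal{S}}$. $\mathrm{HP}_{R}(t)=\sum_{k\ge0}\dim_K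 R_k\,t^k$ for a graded $K$-algebra $R$. $(\mathcal{L},\mathcal{C})$-polyomino: let $r,s\ge2$ and let $\mathcal{L}$ consist (up to translation) of the cells $A=[(0,0),(1,1)]$, $A_j=[(j,0),(j+1,1)]$ for $1\le j\le r$, $B_i=[(0,i),(1,i+1)]$ for $1\le i\le s$. Write $[A,A_r]=\{A,A_1,\dots,A_r\}$, $[A,B_s]=\{A,B_1,\dots,B_s\}$. Put $d_i=(0,i+1)$, $a_i=(1,i+1)$ (upper left and upper right corners of $B_i$), $b_j=(j+1,1)$, $c_j=(j+1,0)$ (upper right and lower right corners of $A_j$). Let $\mathcal{C}$ be a polyomino. A polyomino $\mathcal{P}$ is an $(\mathcal{L},\mathcal{C})$-polyomino if $\mathcal{P}=\mathcal{L}\sqcup\mathcal{C}$ and $V(\mathcal{L})\cap V(\mathcal{C})$ is one of: (1) $\{a_{s-1},a_s,b_{r-1},b_r\}$; (2) $\{a_{s-1},a_s,c_{r-1},c_r\}$; (3) $\{d_{s-1},d_s,b_{r-1},b_r\}$; (4) $\{d_{s-1},d_s,c_{r-1},c_r\}$. For such $\mathcal{P}$: $\mathcal{P}_1=\mathcal{P}\setminus[A,A_r]$; $\mathcal{P}_2=\mathcal{P}\setminus[A,B_s]$; $\mathcal{P}_3=\mathcal{P}\setminus([A,A_r]\cup[A,B_s])=\mathcal{C}$; $\mathcal{P}_4=\mathcal{P}\setminus\{A,A_1,B_1\}$. *)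

theory Defs
  imports
    "HOL-Library.Product_Plus"
    "HOL-Library.Product_Order"
    "HOL-Library.Poly_Mapping"
    "HOL-Computational_Algebra.Formal_Power_Series"
    "HOL-Algebra.QuotRing"
    "HOL-Algebra.Embedded_Algebras"
begin

section \<open>Collections of cells\<close>

text \<open>The order on \<^typ>\<open>int \<times> int\<close> is the componentwise one, so that \<^term>\<open>{u..v}\<close> is the lattice
  interval $[u,v]$.  A cell is identified with the set of its four points, so \<open>V(C) = C\<close>.\<close>

type_synonym point = "int \<times> int"
type_synonym cells = "point set set"

definition cell :: "point \<Rightarrow> point set" where
  "cell u = {u..u + (1, 1)}"

definition cell_edges :: "point \<Rightarrow> point set set" where
  "cell_edges u = {{u, u + (1, 0)}, {u, u + (0, 1)},
                   {u + (1, 0), u + (1, 1)}, {u + (0, 1), u + (1, 1)}}"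

definition share_edge :: "point set \<Rightarrow> point set \<Rightarrow> bool" where
  "share_edge C D \<longleftrightarrow>
     (\<exists>u v. C = cell u \<and> D = cell v \<and> cell_edges u \<inter> cell_edges v \<noteq> {})"

definition polyomino :: "cells \<Rightarrow> bool" where
  "polyomino S \<longleftrightarrow> finite S \<and> S \<noteq> {} \<and> S \<subseteq> range cell \<and>
     (\<forall>C\<in>S. \<forall>D\<in>S. \<exists>Cs. Cs \<noteq> [] \<and> hd Cs = C \<and> last Cs = D \<and> set Cs \<subseteq> S \<and>
        successively share_edge Cs)"

definition vertices :: "cells \<Rightarrow> point set" where
  "vertices S = \<Union>S"

definition proper_interval :: "point \<Rightarrow> point \<Rightarrow> bool" where
  "proper_interval u v \<longleftrightarrow> fst u < fst v \<and> snd u < snd v"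

definition inner_interval :: "cells \<Rightarrow> point \<Rightarrow> point \<Rightarrow> bool" where
  "inner_interval S u v \<longleftrightarrow>
     proper_interval u v \<and> (\<forall>w. cell w \<subseteq> {u..v} \<longrightarrow> cell w \<in> S)"


section \<open>The coordinate ring of a collection of cells\<close>

text \<open>Polynomials over the field \<open>'k\<close> are finitely supported maps from monomials
  (exponent vectors) to coefficients; \<open>poly_ring V\<close> is the polynomial ring
  $K[x_v : v \in V]$ as a ring with carrier.\<close>

type_synonym 'k mpoly = "(point \<Rightarrow>\<^sub>0 nat) \<Rightarrow>\<^sub>0 'k"

definition const_poly :: "'k::field \<Rightarrow> 'k mpoly" where
  "const_poly c = Poly_Mapping.single 0 c"

definition var :: "point \<Rightarrow> 'k::field mpoly" where
  "var v = Poly_Mapping.single (Poly_Mapping.single v 1) 1"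

definition poly_ring :: "point set \<Rightarrow> ('k::field mpoly) ring" where
  "poly_ring V = \<lparr>carrier = {p. \<forall>m\<in>Poly_Mapping.keys p. Poly_Mapping.keys m \<subseteq> V},
     monoid.mult = (*), one = 1, ring.zero = 0, add = (+)\<rparr>"

definition total_degree :: "(point \<Rightarrow>\<^sub>0 nat) \<Rightarrow> nat" where
  "total_degree m = (\<Sum>v\<in>Poly_Mapping.keys m. Poly_Mapping.lookup m v)"

definition homogeneous_part :: "point set \<Rightarrow> nat \<Rightarrow> 'k::field mpoly set" where
  "homogeneous_part V k =
     {p \<in> carrier (poly_ring V). \<forall>m\<in>Poly_Mapping.keys p. total_degree m = k}"

definition inner_minors :: "cells \<Rightarrow> 'k::field mpoly set" where
  "inner_minors S =
     {var (i, j) * var (k, l) - var (i, l) * var (k, j) |i j k l. inner_interval S (i, j) (k, l)}"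

definition polyomino_ideal :: "cells \<Rightarrow> 'k::field mpoly set" where
  "polyomino_ideal S = Idl\<^bsub>poly_ring (vertices S)\<^esub> (inner_minors S)"

definition coordinate_ring :: "cells \<Rightarrow> ('k::field mpoly set) ring" where
  "coordinate_ring S = poly_ring (vertices S) Quot polyomino_ideal S"

abbreviation residue_class :: "cells \<Rightarrow> 'k::field mpoly \<Rightarrow> 'k mpoly set" where
  "residue_class S p \<equiv> polyomino_ideal S +>\<^bsub>poly_ring (vertices S)\<^esub> p"

definition scalars :: "cells \<Rightarrow> 'k::field mpoly set set" where
  "scalars S = residue_class S ` range const_poly"

definition graded_component :: "cells \<Rightarrow> nat \<Rightarrow> 'k::field mpoly set set" where
  "graded_component S k = residue_class S ` homogeneous_part (vertices S) k"


section \<open>Hilbert--Poincare series\<close>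

text \<open>For a ring \<open>R\<close> containing a field \<open>F\<close>, with \<open>G k\<close> the component of degree \<open>k\<close>.
  The coefficients are taken in the rationals so that division by powers of $1-t$ is available.\<close>

definition hilbert_poincare :: "('a, 'b) ring_scheme \<Rightarrow> 'a set \<Rightarrow> (nat \<Rightarrow> 'a set) \<Rightarrow> rat fps" where
  "hilbert_poincare R F G = Abs_fps (\<lambda>k. of_nat (ring.dim R F (G k)))"

text \<open>The type argument is the ground field.\<close>

definition HP :: "'k::field itself \<Rightarrow> cells \<Rightarrow> rat fps" where
  "HP _ S = hilbert_poincare (coordinate_ring S :: ('k mpoly set) ring)
     (scalars S) (graded_component S)"


section \<open>\<open>(\<L>,\<C>)\<close>-polyominoes\<close>

text \<open>The point \<open>p\<close> is the lower left corner of the cell \<open>A\<close>; it accounts for translations.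
  With \<open>A\<^sub>0 = B\<^sub>0 = A\<close>, the cells of \<open>\<L>\<close> are \<open>A\<^sub>0, \<dots>, A\<^sub>r, B\<^sub>1, \<dots>, B\<^sub>s\<close>.\<close>

definition cellA :: "point \<Rightarrow> nat \<Rightarrow> point set" where
  "cellA p j = cell (p + (int j, 0))"

definition cellB :: "point \<Rightarrow> nat \<Rightarrow> point set" where
  "cellB p i = cell (p + (0, int i))"

definition row_cells :: "point \<Rightarrow> nat \<Rightarrow> cells" where
  "row_cells p r = cellA p ` {0..r}"

definition column_cells :: "point \<Rightarrow> nat \<Rightarrow> cells" where
  "column_cells p s = cellB p ` {0..s}"

definition cells_L :: "point \<Rightarrow> nat \<Rightarrow> nat \<Rightarrow> cells" where
  "cells_L p r s = row_cells p r \<union> column_cells p s"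

definition pt_a :: "point \<Rightarrow> nat \<Rightarrow> point" where
  "pt_a p i = p + (1, int i + 1)"

definition pt_b :: "point \<Rightarrow> nat \<Rightarrow> point" where
  "pt_b p j = p + (int j + 1, 1)"

definition pt_c :: "point \<Rightarrow> nat \<Rightarrow> point" where
  "pt_c p j = p + (int j + 1, 0)"

definition pt_d :: "point \<Rightarrow> nat \<Rightarrow> point" where
  "pt_d p i = p + (0, int i + 1)"

definition LC_polyomino :: "point \<Rightarrow> nat \<Rightarrow> nat \<Rightarrow> cells \<Rightarrow> cells \<Rightarrow> bool" where
  "LC_polyomino p r s C P \<longleftrightarrow>
     2 \<le> r \<and> 2 \<le> s \<and> polyomino C \<and> polyomino P \<and>
     P = cells_L p r s \<union> C \<and> cells_L p r s \<inter> C = {} \<and>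
     vertices (cells_L p r s) \<inter> vertices C \<in>
       {{pt_a p (s - 1), pt_a p s, pt_b p (r - 1), pt_b p r},
        {pt_a p (s - 1), pt_a p s, pt_c p (r - 1), pt_c p r},
        {pt_d p (s - 1), pt_d p s, pt_b p (r - 1), pt_b p r},
        {pt_d p (s - 1), pt_d p s, pt_c p (r - 1), pt_c p r}}"

end

theory Submission
  imports Defs
begin

text \<open>
  The vertices of \<open>\<L>\<close> lie on four lines: the two lattice rows of the bar \<open>[A, A\<^sub>r]\<close> and the two
  lattice columns of the bar \<open>[A, B\<^sub>s]\<close>.  In each of the four configurations, \<open>\<C>\<close> meets exactly one
  of the two rows, at height \<open>yw\<close>, and exactly one of the two columns, at abscissa \<open>xw\<close>; the other row
  \<open>yu\<close> and the other column \<open>xu\<close> are unattached.  The corners of the cell \<open>A\<close> are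
  \<open>x\<^sub>1 = (xu, yu)\<close>, \<open>x\<^sub>2 = (xw, yu)\<close>, \<open>x\<^sub>3 = (xu, yw)\<close> and \<open>x\<^sub>4 = (xw, yw)\<close>.

  Let \<open>I\<close> be the polyomino ideal in the polynomial ring \<open>S\<close>, and adjoin these variables one at a time:
  \<open>J\<^sub>0 = (I, x\<^sub>1)\<close>, \<open>J\<^sub>1 = (J\<^sub>0, x\<^sub>2)\<close>, \<open>J\<^sub>2 = (J\<^sub>1, x\<^sub>3)\<close>, \<open>J\<^sub>3 = (J\<^sub>2, x\<^sub>4)\<close>.  For a homogeneous ideal \<open>J\<close> and
  a variable \<open>x\<close>, multiplication by \<open>x\<close> gives \<open>H(S/J) = t H(S/(J : x)) + H(S/(J, x))\<close>
  (\<open>hilbert_series_colon\<close>).  The colon ideals that occur are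
  \<open>I : x\<^sub>1 = I\<close>, \<open>J\<^sub>0 : x\<^sub>2 = X\<^sub>2\<close>, \<open>J\<^sub>1 : x\<^sub>3 = X\<^sub>1\<close> and \<open>J\<^sub>2 : x\<^sub>4 = X\<^sub>3\<close>, where \<open>X\<^sub>1\<close>, \<open>X\<^sub>2\<close>, \<open>X\<^sub>3\<close> arise from
  \<open>I\<close> by adjoining all variables of the unattached row, of the unattached column, and of both.
  The inclusions from right to left come from the minors of the two bars: for instance
  \<open>x\<^sub>2 v\<close> is congruent to \<open>x\<^sub>1 v'\<close> modulo \<open>I\<close> for \<open>v\<close> on the unattached column and \<open>v'\<close> its neighbour on
  the other one.  The inclusions from left to right hold because \<open>I\<close>, \<open>X\<^sub>1\<close>, \<open>X\<^sub>2\<close>, \<open>X\<^sub>3\<close> are prime and do not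
  contain the variable in question (\<open>colon_preimage_ideal\<close>).

  Killing a line of variables turns every minor of \<open>\<P>\<close> into zero or into a minor of \<open>\<P>\<^sub>1\<close>, \<open>\<P>\<^sub>2\<close> or
  \<open>\<P>\<^sub>3\<close>, up to renaming two variables (\<open>retraction_P1\<close>, \<open>retraction_P2\<close>, \<open>retraction_P3\<close>), and the
  polynomial ring of the smaller collection embeds back in such a way that minors go to minors.
  Therefore the smaller polyomino ideal is the contraction of \<open>I\<close>, hence prime, and its preimage \<open>X\<^sub>i\<close>
  is prime as well.  The same retractions give \<open>S/X\<^sub>i = K[\<P>\<^sub>i][free variables]\<close>, with \<open>r - 2\<close>, \<open>s - 2\<close>
  and \<open>s + r - 3\<close> vertices left over as free variables, and \<open>S/J\<^sub>3 = K[\<P>\<^sub>4]\<close> (\<open>retraction_P4\<close>).  Adding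
  up the four equations of Hilbert series gives the formula.  What makes the retractions work is
  the list of all inner intervals of \<open>\<P>\<close> (\<open>inner_interval_P_cases\<close>): besides those inside the two bars
  and those inside \<open>\<C>\<close>, there are only intervals that prolong the last cell of a bar into \<open>\<C>\<close>, and
  these have two corners on the unattached line and the other two in \<open>\<C>\<close>.
\<close>

section \<open>Dimensions of quotient spaces\<close>

text \<open>Polynomials form an infinite-dimensional space, so the finiteness that the count needs is supplied
  by a finite set whose span contains \<open>S\<close>.\<close>

lemma (in vector_space) dim_insert_outside_span:
  assumes "finite F" "S \<subseteq> span F" "v \<notin> span S"
  shows "dim (insert v S) = Suc (dim S)"
proof -
  obtain B where B: "B \<subseteq> S" "independent B" "S \<subseteq> span B" "card B = dim S"
    using basis_exists[of S] by metis
  have finB: "finite B"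
    using independent_span_bound[OF assms(1) B(2)] B(1) assms(2) by blast
  have "span B = span S"
    using B by (metis span_mono span_span subset_antisym)
  then have v: "v \<notin> span B" using assms(3) by simp
  then have "independent (insert v B)" using B(2) independent_insertI by blast
  moreover have "insert v S \<subseteq> span (insert v B)"
    by (metis B(3) insert_subset span_base insertI1 span_mono subset_insertI subset_trans)
  moreover have "insert v B \<subseteq> insert v S" using B(1) by blast
  ultimately have "dim (insert v S) = card (insert v B)"
    using basis_card_eq_dim by metis
  moreover have "v \<notin> B" using v span_base by blast
  ultimately show ?thesis using finB B(4) by simp
qed

lemma (in vector_space) dim_insert_in_span:
  assumes "v \<in> span S"
  shows "dim (insert v S) = dim S"
  using span_eq_dim span_redundant[OF assms] by blast

text \<open>A linear map that is onto modulo \<open>B0\<close> induces an isomorphism of \<open>A / A0\<close> with \<open>B / B0\<close>.  The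
  dimensions are compared by adding the elements of a basis of \<open>A\<close> to \<open>A0\<close> one at a time and their
  images to \<open>B0\<close>: both dimensions grow at the same steps.  Every comparison of Hilbert functions below
  is an instance of this lemma.\<close>

lemma (in vector_space_pair) codim_transfer:
  assumes f: "Vector_Spaces.linear s1 s2 f"
    and F1: "finite F1" "A \<subseteq> vs1.span F1" and F2: "finite F2" "B \<subseteq> vs2.span F2"
    and sub: "vs1.subspace A" "vs1.subspace A0" "vs2.subspace B" "vs2.subspace B0"
    and A0: "A0 = {a \<in> A. f a \<in> B0}" and B0: "B0 \<subseteq> B" and fA: "f ` A \<subseteq> B"
    and surj: "\<And>b. b \<in> B \<Longrightarrow> \<exists>a\<in>A. b - f a \<in> B0"
  shows "vs1.dim A + vs2.dim B0 = vs2.dim B + vs1.dim A0"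
proof -
  interpret f: Vector_Spaces.linear s1 s2 f by (rule f)
  have key: "v \<in> vs1.span (A0 \<union> T) \<longleftrightarrow> f v \<in> vs2.span (B0 \<union> f ` T)" if "T \<subseteq> A" "v \<in> A" for T v
  proof
    assume "v \<in> vs1.span (A0 \<union> T)"
    then have "f v \<in> f ` vs1.span (A0 \<union> T)" by blast
    also have "\<dots> = vs2.span (f ` (A0 \<union> T))" using f.span_image by simp
    also have "\<dots> \<subseteq> vs2.span (B0 \<union> f ` T)"
      by (rule vs2.span_mono) (use A0 in auto)
    finally show "f v \<in> vs2.span (B0 \<union> f ` T)" .
  next
    assume "f v \<in> vs2.span (B0 \<union> f ` T)"
    then obtain b t where bt: "f v = b + t" "b \<in> vs2.span B0" "t \<in> vs2.span (f ` T)"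
      by (auto simp: vs2.span_Un)
    then have b: "b \<in> B0" using sub(4) vs2.span_eq_iff by blast
    have "vs2.span (f ` T) = f ` vs1.span T" using f.span_image by simp
    then obtain t' where t': "t = f t'" "t' \<in> vs1.span T" using bt by blast
    have "vs1.span T \<subseteq> A" using that(1) sub(1) by (rule vs1.span_minimal)
    then have "v - t' \<in> A" using t'(2) that(2) sub(1) vs1.subspace_diff by blast
    moreover have "f (v - t') \<in> B0" using bt t' b f.diff by simp
    ultimately have "v - t' \<in> A0" using A0 by simp
    then have "v - t' \<in> vs1.span (A0 \<union> T)" by (simp add: vs1.span_base)
    moreover have "t' \<in> vs1.span (A0 \<union> T)" using t'(2) vs1.span_mono[of T "A0 \<union> T"] by blast
    ultimately have "(v - t') + t' \<in> vs1.span (A0 \<union> T)" using vs1.span_add by blast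
    then show "v \<in> vs1.span (A0 \<union> T)" by simp
  qed
  have ind: "vs1.dim (A0 \<union> T) + vs2.dim B0 = vs2.dim (B0 \<union> f ` T) + vs1.dim A0"
    if "finite T" "T \<subseteq> A" for T
    using that
  proof (induction T rule: finite_induct)
    case empty
    then show ?case by simp
  next
    case (insert v T)
    show ?case
    proof (cases "v \<in> vs1.span (A0 \<union> T)")
      case True
      then show ?thesis
        using key[of T v] insert vs1.dim_insert_in_span[of v "A0 \<union> T"]
          vs2.dim_insert_in_span[of "f v" "B0 \<union> f ` T"] by simp
    next
      case False
      have "A0 \<union> T \<subseteq> vs1.span F1" using A0 insert.prems F1 by auto
      moreover have "B0 \<union> f ` T \<subseteq> vs2.span F2" using B0 F2 fA insert.prems by blast
      ultimately show ?thesis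
        using False key[of T v] insert vs1.dim_insert_outside_span[of F1 "A0 \<union> T" v]
          vs2.dim_insert_outside_span[of F2 "B0 \<union> f ` T" "f v"] F1 F2 by simp
    qed
  qed
  obtain T where T: "T \<subseteq> A" "vs1.independent T" "A \<subseteq> vs1.span T"
    using vs1.basis_exists[of A] by metis
  have finT: "finite T" using vs1.independent_span_bound[OF F1(1) T(2)] T(1) F1(2) by blast
  have "vs1.span (A0 \<union> T) = vs1.span A"
  proof (rule vs1.span_eq[THEN iffD2], intro conjI)
    show "A0 \<union> T \<subseteq> vs1.span A" using A0 T vs1.span_base by blast
    show "A \<subseteq> vs1.span (A0 \<union> T)" using T(3) vs1.span_mono[of T "A0 \<union> T"] by blast
  qed
  then have 1: "vs1.dim (A0 \<union> T) = vs1.dim A" using vs1.span_eq_dim by blast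
  have "vs2.span (B0 \<union> f ` T) = vs2.span B"
  proof (rule vs2.span_eq[THEN iffD2], intro conjI subsetI)
    show "x \<in> vs2.span B" if "x \<in> B0 \<union> f ` T" for x
      using that B0 fA T(1) vs2.span_base by blast
    show "b \<in> vs2.span (B0 \<union> f ` T)" if "b \<in> B" for b
    proof -
      obtain a where a: "a \<in> A" "b - f a \<in> B0" using surj \<open>b \<in> B\<close> by blast
      have "f a \<in> f ` vs1.span T" using a T by blast
      also have "\<dots> = vs2.span (f ` T)" using f.span_image by simp
      finally have "f a \<in> vs2.span (B0 \<union> f ` T)" using vs2.span_mono[of "f ` T"] by blast
      moreover have "b - f a \<in> vs2.span (B0 \<union> f ` T)" using a by (simp add: vs2.span_base)
      ultimately have "(b - f a) + f a \<in> vs2.span (B0 \<union> f ` T)" using vs2.span_add by blast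
      then show ?thesis by simp
    qed
  qed
  then have "vs2.dim (B0 \<union> f ` T) = vs2.dim B" using vs2.span_eq_dim by blast
  with ind[OF finT T(1)] 1 show ?thesis by simp
qed

section \<open>Polynomials over a set of variables\<close>

lemma const_poly_simps [simp]:
  "const_poly 0 = 0" "const_poly 1 = 1"
  "const_poly (a + b) = const_poly a + const_poly b"
  "const_poly (a * b) = const_poly a * const_poly b"
  by (simp_all add: const_poly_def single_add mult_single)

lemma lookup_const_times [simp]:
  "Poly_Mapping.lookup (const_poly c * p) m = c * Poly_Mapping.lookup p m"
proof -
  have "const_poly c * p = Poly_Mapping.map ((*) c) p"
    by (simp add: const_poly_def mult_map_scale_conv_mult)
  then show ?thesis by (simp add: Poly_Mapping.map.rep_eq when_def)
qed

lemma const_times_single: "const_poly c * Poly_Mapping.single m d = Poly_Mapping.single m (c * d)"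
  by (simp add: const_poly_def mult_single)

global_interpretation mpv: vector_space "\<lambda>c (p :: 'k::field mpoly). const_poly c * p"
  by unfold_locales (simp_all add: algebra_simps)

global_interpretation mpv2: vector_space_pair "\<lambda>c (p :: 'k::field mpoly). const_poly c * p"
   "\<lambda>c (p :: 'k::field mpoly). const_poly c * p"
  by unfold_locales

lemma mpoly_as_sum:
  "p = (\<Sum>m\<in>Poly_Mapping.keys p. Poly_Mapping.single m (Poly_Mapping.lookup p m))"
  by (rule poly_mapping_eqI)
    (simp add: lookup_sum lookup_single when_def in_keys_iff)

text \<open>The step for single terms is restricted to the terms of the given polynomial, so that membership
  conditions on its monomials are available there.\<close>

lemma mpoly_induct [case_names zero single add]:
  fixes p :: "'k::field mpoly"
  assumes "P 0" "\<And>m. m \<in> Poly_Mapping.keys p \<Longrightarrow> P (Poly_Mapping.single m (Poly_Mapping.lookup p m))"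
    "\<And>p q. P p \<Longrightarrow> P q \<Longrightarrow> P (p + q)"
  shows "P p"
proof -
  have "P (\<Sum>m\<in>M. Poly_Mapping.single m (Poly_Mapping.lookup p m))"
    if "finite M" "M \<subseteq> Poly_Mapping.keys p" for M
    using that by (induction rule: finite_induct) (use assms in auto)
  from this[of "Poly_Mapping.keys p"] show ?thesis using mpoly_as_sum[of p] by simp
qed

lemma keys_add_nat: "Poly_Mapping.keys (m + n :: point \<Rightarrow>\<^sub>0 nat) = Poly_Mapping.keys m \<union> Poly_Mapping.keys n"
  by (auto simp: in_keys_iff lookup_add)

abbreviation polys :: "point set \<Rightarrow> 'k::field mpoly set" where
  "polys V \<equiv> carrier (poly_ring V)"

lemma polys_iff: "p \<in> polys V \<longleftrightarrow> (\<forall>m\<in>Poly_Mapping.keys p. Poly_Mapping.keys m \<subseteq> V)"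
  by (simp add: poly_ring_def)

lemma polys_zero [simp]: "0 \<in> polys V" and polys_one [simp]: "1 \<in> polys V"
  and polys_const [simp]: "const_poly c \<in> polys V"
  and polys_single: "Poly_Mapping.keys m \<subseteq> V \<Longrightarrow> Poly_Mapping.single m c \<in> polys V"
  and polys_var [simp]: "var v \<in> polys V \<longleftrightarrow> v \<in> V"
  by (auto simp: polys_iff const_poly_def var_def)

lemma polys_add: "p \<in> polys V \<Longrightarrow> q \<in> polys V \<Longrightarrow> p + q \<in> polys V"
  unfolding polys_iff using keys_add[of p q] by blast

lemma polys_mult: "p \<in> polys V \<Longrightarrow> q \<in> polys V \<Longrightarrow> p * q \<in> polys V"
  unfolding polys_iff using keys_mult[of p q] by (fastforce simp: keys_add_nat)

lemma polys_uminus: "p \<in> polys V \<Longrightarrow> - p \<in> polys V"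
  by (simp add: polys_iff)

lemma polys_mono: "V \<subseteq> W \<Longrightarrow> polys V \<subseteq> polys W"
  unfolding subset_iff polys_iff by blast

lemma poly_ring_simps [simp]:
  "(\<otimes>\<^bsub>poly_ring V\<^esub>) = (*)" "(\<oplus>\<^bsub>poly_ring V\<^esub>) = (+)" "\<one>\<^bsub>poly_ring V\<^esub> = 1" "\<zero>\<^bsub>poly_ring V\<^esub> = 0"
  by (simp_all add: poly_ring_def)

lemma cring_poly_ring: "cring (poly_ring V :: ('k::field mpoly) ring)"
proof (rule cringI)
  show "abelian_group (poly_ring V :: ('k mpoly) ring)"
  proof (rule abelian_groupI)
    fix x assume "x \<in> polys V"
    then show "\<exists>y\<in>polys V. y \<oplus>\<^bsub>poly_ring V\<^esub> x = \<zero>\<^bsub>poly_ring V\<^esub>"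
      by (intro bexI[of _ "- x"]) (simp_all add: polys_uminus)
  qed (simp_all add: polys_add add_ac)
  show "comm_monoid (poly_ring V :: ('k mpoly) ring)"
    by (rule comm_monoidI) (simp_all add: polys_mult mult_ac)
qed (simp add: algebra_simps)

section \<open>Homogeneous polynomials\<close>

lemma total_degree_superset:
  assumes "finite A" "Poly_Mapping.keys m \<subseteq> A"
  shows "total_degree m = (\<Sum>v\<in>A. Poly_Mapping.lookup m v)"
  unfolding total_degree_def
  by (rule sum.mono_neutral_left) (use assms in \<open>auto simp: in_keys_iff\<close>)

lemma total_degree_add: "total_degree (m + n) = total_degree m + total_degree n"
  by (simp add: total_degree_superset[of "Poly_Mapping.keys m \<union> Poly_Mapping.keys n"]
      keys_add_nat lookup_add sum.distrib)

lemma homogeneous_part_iff: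
  "p \<in> homogeneous_part V k \<longleftrightarrow> p \<in> polys V \<and> (\<forall>m\<in>Poly_Mapping.keys p. total_degree m = k)"
  by (simp add: homogeneous_part_def)

lemma homogeneous_part_polys: "p \<in> homogeneous_part V k \<Longrightarrow> p \<in> polys V"
  by (simp add: homogeneous_part_iff)

lemma homogeneous_zero: "0 \<in> homogeneous_part V k"
  by (simp add: homogeneous_part_iff)

lemma homogeneous_single:
  "Poly_Mapping.keys m \<subseteq> V \<Longrightarrow> total_degree m = k \<Longrightarrow> Poly_Mapping.single m c \<in> homogeneous_part V k"
  by (auto simp: homogeneous_part_iff polys_single split: if_splits)

lemma homogeneous_var: "v \<in> V \<Longrightarrow> var v \<in> homogeneous_part V 1"
  unfolding var_def by (rule homogeneous_single) (auto simp: total_degree_def)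

lemma homogeneous_const: "const_poly c \<in> homogeneous_part V 0"
  unfolding const_poly_def by (rule homogeneous_single) (auto simp: total_degree_def)

lemma homogeneous_add:
  "p \<in> homogeneous_part V k \<Longrightarrow> q \<in> homogeneous_part V k \<Longrightarrow> p + q \<in> homogeneous_part V k"
  unfolding homogeneous_part_iff using keys_add[of p q] by (auto intro: polys_add)

lemma homogeneous_mult:
  "p \<in> homogeneous_part V k \<Longrightarrow> q \<in> homogeneous_part V l \<Longrightarrow> p * q \<in> homogeneous_part V (k + l)"
  unfolding homogeneous_part_iff using keys_mult[of p q]
  by (fastforce intro: polys_mult simp: total_degree_add)

lemma homogeneous_uminus: "p \<in> homogeneous_part V k \<Longrightarrow> - p \<in> homogeneous_part V k"
  by (simp add: homogeneous_part_iff polys_uminus)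

lemma homogeneous_diff:
  "p \<in> homogeneous_part V k \<Longrightarrow> q \<in> homogeneous_part V k \<Longrightarrow> p - q \<in> homogeneous_part V k"
  using homogeneous_add[of p V k "- q"] homogeneous_uminus by auto

lemma homogeneous_power: "p \<in> homogeneous_part V 1 \<Longrightarrow> p ^ n \<in> homogeneous_part V n"
proof (induction n)
  case 0
  then show ?case using homogeneous_const[of 1 V] by simp
next
  case (Suc n)
  then show ?case using homogeneous_mult[of p V 1 "p ^ n" n] by simp
qed

lemma subspace_homogeneous_part: "mpv.subspace (homogeneous_part V k)"
  unfolding mpv.subspace_def
proof (intro conjI allI ballI)
  fix c and x :: "'a mpoly" assume "x \<in> homogeneous_part V k"
  then show "const_poly c * x \<in> homogeneous_part V k"
    using homogeneous_mult[OF homogeneous_const] by (metis add_0)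
qed (auto simp: homogeneous_zero homogeneous_add)

lemma finite_monomials:
  assumes "finite V"
  shows "finite {m. Poly_Mapping.keys m \<subseteq> V \<and> total_degree m = k}" (is "finite ?M")
proof -
  have "Poly_Mapping.lookup ` ?M \<subseteq> {f. \<forall>v. (v \<in> V \<longrightarrow> f v \<in> {..k}) \<and> (v \<notin> V \<longrightarrow> f v = 0)}"
  proof clarsimp
    fix m :: "point \<Rightarrow>\<^sub>0 nat" and v assume m: "Poly_Mapping.keys m \<subseteq> V"
    show "(v \<in> V \<longrightarrow> Poly_Mapping.lookup m v \<le> total_degree m) \<and> (v \<notin> V \<longrightarrow> Poly_Mapping.lookup m v = 0)"
      using m assms member_le_sum[of v V "Poly_Mapping.lookup m"]
      by (auto simp: total_degree_superset[OF assms m] in_keys_iff)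
  qed
  moreover have "finite {f. \<forall>v. (v \<in> V \<longrightarrow> f v \<in> {..k}) \<and> (v \<notin> V \<longrightarrow> f v = (0::nat))}"
    by (rule finite_set_of_finite_funs) (use assms in simp_all)
  ultimately have "finite (Poly_Mapping.lookup ` ?M)" by (rule finite_subset)
  moreover have "inj_on Poly_Mapping.lookup ?M"
    by (rule inj_onI) (metis poly_mapping_eqI)
  ultimately show ?thesis by (rule finite_imageD)
qed

lemma homogeneous_part_finite_span:
  assumes "finite V"
  obtains F where "finite F" "homogeneous_part V k \<subseteq> mpv.span F"
proof
  let ?F = "(\<lambda>m. Poly_Mapping.single m (1::'a)) ` {m. Poly_Mapping.keys m \<subseteq> V \<and> total_degree m = k}"
  show "finite ?F" using finite_monomials[OF assms] by blast
  show "homogeneous_part V k \<subseteq> mpv.span ?F"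
  proof
    fix p :: "'a mpoly" assume p: "p \<in> homogeneous_part V k"
    show "p \<in> mpv.span ?F"
    proof (induction p rule: mpoly_induct)
      case (single m)
      then have "Poly_Mapping.single m 1 \<in> ?F" using p by (auto simp: homogeneous_part_iff polys_iff)
      then have "const_poly (Poly_Mapping.lookup p m) * Poly_Mapping.single m 1 \<in> mpv.span ?F"
        by (intro mpv.span_scale mpv.span_base)
      then show ?case by (simp add: const_times_single)
    qed (auto intro: mpv.span_zero mpv.span_add)
  qed
qed

definition homogeneous_component :: "nat \<Rightarrow> 'k::field mpoly \<Rightarrow> 'k mpoly" where
  "homogeneous_component k p = Poly_Mapping.mapp (\<lambda>m c. c when total_degree m = k) p"

lemma lookup_homogeneous_component:
  "Poly_Mapping.lookup (homogeneous_component k p) m = (Poly_Mapping.lookup p m when total_degree m = k)"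
  by (auto simp: homogeneous_component_def Poly_Mapping.lookup_mapp when_def in_keys_iff)

lemma homogeneous_component_add:
  "homogeneous_component k (p + q) = homogeneous_component k p + homogeneous_component k q"
  by (rule poly_mapping_eqI) (simp add: lookup_homogeneous_component lookup_add when_def)

lemma homogeneous_component_zero [simp]: "homogeneous_component k 0 = 0"
  by (rule poly_mapping_eqI) (simp add: lookup_homogeneous_component)

lemma homogeneous_component_single:
  "homogeneous_component k (Poly_Mapping.single m c) = (if total_degree m = k then Poly_Mapping.single m c else 0)"
  by (rule poly_mapping_eqI) (auto simp: lookup_homogeneous_component lookup_single when_def)

lemma homogeneous_component_in:
  assumes "p \<in> polys V" shows "homogeneous_component k p \<in> homogeneous_part V k"
  using assms unfolding homogeneous_part_iff polys_iff
  by (auto simp: in_keys_iff lookup_homogeneous_component when_def split: if_splits)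

lemma homogeneous_component_homogeneous:
  "p \<in> homogeneous_part V d \<Longrightarrow> homogeneous_component k p = (if k = d then p else 0)"
  by (rule poly_mapping_eqI)
    (auto simp: lookup_homogeneous_component homogeneous_part_iff when_def in_keys_iff)

lemma homogeneous_component_mult:
  assumes "g \<in> homogeneous_part V d"
  shows "homogeneous_component k (q * g) = (if d \<le> k then homogeneous_component (k - d) q * g else 0)"
proof (induction q rule: mpoly_induct)
  case (single m)
  let ?c = "Poly_Mapping.lookup q m"
  let ?V = "V \<union> Poly_Mapping.keys m"
  have "Poly_Mapping.single m ?c * g \<in> homogeneous_part ?V (total_degree m + d)"
    using assms by (intro homogeneous_mult homogeneous_single) (auto simp: homogeneous_part_iff polys_iff)
  from homogeneous_component_homogeneous[OF this]
  show ?case by (auto simp: homogeneous_component_single)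
qed (auto simp: homogeneous_component_add algebra_simps)

section \<open>Ideals generated by polynomials\<close>

text \<open>The ideal of \<open>K[x\<^sub>v : v \<in> V]\<close> generated by \<open>G\<close>, built from finite sums of multiples of generators.
  Membership proofs become inductions inside the type class of commutative rings, and the set \<open>V\<close> of
  variables can be varied without changing the ambient type.\<close>

inductive_set ideal_gen :: "point set \<Rightarrow> 'k::field mpoly set \<Rightarrow> 'k mpoly set"
  for V G where
  zero: "0 \<in> ideal_gen V G"
| step: "r \<in> ideal_gen V G \<Longrightarrow> q \<in> polys V \<Longrightarrow> g \<in> G \<Longrightarrow> r + q * g \<in> ideal_gen V G"

lemma ideal_gen_add:
  assumes "a \<in> ideal_gen V G" "b \<in> ideal_gen V G" shows "a + b \<in> ideal_gen V G"
  using assms(2,1)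
proof (induction b rule: ideal_gen.induct)
  case (step r q g)
  then show ?case using ideal_gen.step[of "a + r" V G q g] by (simp add: add.assoc)
qed simp

lemma ideal_gen_mult: "a \<in> ideal_gen V G \<Longrightarrow> p \<in> polys V \<Longrightarrow> p * a \<in> ideal_gen V G"
proof (induction a rule: ideal_gen.induct)
  case (step r q g)
  then have "p * r + (p * q) * g \<in> ideal_gen V G"
    by (intro ideal_gen.step polys_mult)
  then show ?case by (simp add: algebra_simps)
qed (simp add: ideal_gen.zero)

lemma ideal_gen_mult2: "a \<in> ideal_gen V G \<Longrightarrow> p \<in> polys V \<Longrightarrow> a * p \<in> ideal_gen V G"
  using ideal_gen_mult by (metis mult.commute)

lemma ideal_gen_base: "g \<in> G \<Longrightarrow> g \<in> ideal_gen V G"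
  using ideal_gen.step[OF ideal_gen.zero, of 1 V g G] by simp

lemma ideal_gen_uminus: "a \<in> ideal_gen V G \<Longrightarrow> - a \<in> ideal_gen V G"
  using ideal_gen_mult[of a V G "- 1"] by (simp add: polys_uminus)

lemma ideal_gen_least:
  assumes "a \<in> ideal_gen V G" "\<And>g. g \<in> G \<Longrightarrow> g \<in> ideal_gen W G'" "V \<subseteq> W"
  shows "a \<in> ideal_gen W G'"
  using assms(1)
proof (induction a rule: ideal_gen.induct)
  case (step r q g)
  then show ?case
    using assms polys_mono[OF assms(3)] by (blast intro: ideal_gen_add ideal_gen_mult)
qed (rule ideal_gen.zero)

lemma ideal_gen_mono: "G \<subseteq> G' \<Longrightarrow> ideal_gen V G \<subseteq> ideal_gen V G'"
  by (meson ideal_gen_base ideal_gen_least subset_iff order_refl)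

lemma ideal_gen_polys:
  assumes "G \<subseteq> polys V" "a \<in> ideal_gen V G" shows "a \<in> polys V"
  using assms(2,1) by (induction a rule: ideal_gen.induct) (auto intro: polys_add polys_mult)

lemma subspace_ideal_gen: "mpv.subspace (ideal_gen V G)"
  by (auto simp: mpv.subspace_def intro: ideal_gen.zero ideal_gen_add ideal_gen_mult)

lemma poly_ring_uminus: "a \<in> polys V \<Longrightarrow> \<ominus>\<^bsub>poly_ring V\<^esub> a = - (a :: 'k::field mpoly)"
proof -
  interpret cring "poly_ring V :: ('k mpoly) ring" by (rule cring_poly_ring)
  assume "a \<in> polys V"
  then show ?thesis by (intro sum_zero_eq_neg[symmetric]) (simp_all add: polys_uminus)
qed

lemma poly_ring_minus:
  "a \<in> polys V \<Longrightarrow> b \<in> polys V \<Longrightarrow> a \<ominus>\<^bsub>poly_ring V\<^esub> b = a - (b :: 'k::field mpoly)"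
  by (simp add: a_minus_def poly_ring_uminus)

lemma ideal_ideal_gen:
  assumes "G \<subseteq> polys V"
  shows "ideal (ideal_gen V G) (poly_ring V :: ('k::field mpoly) ring)"
proof (rule idealI)
  interpret cring "poly_ring V :: ('k mpoly) ring" by (rule cring_poly_ring)
  show "ring (poly_ring V :: ('k mpoly) ring)" by (rule ring_axioms)
  show "subgroup (ideal_gen V G) (add_monoid (poly_ring V :: ('k mpoly) ring))"
  proof (rule add.subgroupI)
    show "ideal_gen V G \<noteq> {}" using ideal_gen.zero by blast
    fix a assume a: "a \<in> ideal_gen V G"
    then have "\<ominus>\<^bsub>poly_ring V\<^esub> a = - a"
      using ideal_gen_polys[OF assms] by (simp add: poly_ring_uminus)
    then show "\<ominus>\<^bsub>poly_ring V\<^esub> a \<in> ideal_gen V G" using a ideal_gen_uminus by simp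
  qed (use ideal_gen_polys[OF assms] in \<open>auto simp: ideal_gen_add\<close>)
qed (simp_all add: ideal_gen_mult ideal_gen_mult2)

text \<open>The link to the ideals of the carrier-based rings in which the coordinate ring is defined.\<close>

lemma genideal_eq_ideal_gen:
  fixes G :: "'k::field mpoly set"
  assumes "G \<subseteq> polys V"
  shows "Idl\<^bsub>poly_ring V\<^esub> G = ideal_gen V G"
proof
  interpret cring "poly_ring V :: ('k mpoly) ring" by (rule cring_poly_ring)
  show "Idl\<^bsub>poly_ring V\<^esub> G \<subseteq> ideal_gen V G"
    using genideal_minimal[OF ideal_ideal_gen[OF assms]] ideal_gen_base by blast
  interpret J: ideal "Idl\<^bsub>poly_ring V\<^esub> G" "poly_ring V" by (rule genideal_ideal[OF assms])
  show "ideal_gen V G \<subseteq> Idl\<^bsub>poly_ring V\<^esub> G"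
  proof
    fix a assume "a \<in> ideal_gen V G"
    then show "a \<in> Idl\<^bsub>poly_ring V\<^esub> G"
    proof (induction a rule: ideal_gen.induct)
      case zero
      then show ?case using J.zero_closed by simp
    next
      case (step r q g)
      then have "g \<in> Idl\<^bsub>poly_ring V\<^esub> G" using genideal_self[OF assms] by blast
      then have "q * g \<in> Idl\<^bsub>poly_ring V\<^esub> G" using J.I_l_closed step(2) by simp
      then show ?case using J.a_closed step(4) by simp
    qed
  qed
qed

text \<open>Multiples of polynomials without terms of degree less than \<open>d\<close> have no such terms either.  For \<open>d = 2\<close>
  this keeps nonzero constants and variables out of the ideal of inner minors.\<close>

lemma ideal_gen_degree_ge:
  assumes "a \<in> ideal_gen V G" "\<And>g m. g \<in> G \<Longrightarrow> m \<in> Poly_Mapping.keys g \<Longrightarrow> d \<le> total_degree m"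
    "m \<in> Poly_Mapping.keys a"
  shows "d \<le> total_degree m"
  using assms(1,3)
proof (induction a arbitrary: m rule: ideal_gen.induct)
  case (step r q g)
  from step.prems consider "m \<in> Poly_Mapping.keys r" | "m \<in> Poly_Mapping.keys (q * g)"
    using keys_add[of r "q * g"] by blast
  then show ?case
  proof cases
    case 2
    then obtain x y where "m = x + y" "y \<in> Poly_Mapping.keys g" using keys_mult[of q g] by blast
    then show ?thesis using assms(2)[OF step(3)] by (fastforce simp: total_degree_add)
  qed (use step in blast)
qed simp

definition homogeneous_set :: "point set \<Rightarrow> 'k::field mpoly set \<Rightarrow> bool" where
  "homogeneous_set V G \<longleftrightarrow> (\<forall>g\<in>G. \<exists>d. g \<in> homogeneous_part V d)"

text \<open>An ideal generated by forms contains the homogeneous components of its elements, because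
  the components of \<open>q * g\<close> are multiples of \<open>g\<close>.\<close>

lemma homogeneous_component_ideal_gen:
  assumes "homogeneous_set V G" "a \<in> ideal_gen V G"
  shows "homogeneous_component k a \<in> ideal_gen V G"
  using assms(2)
proof (induction a rule: ideal_gen.induct)
  case (step r q g)
  obtain d where d: "g \<in> homogeneous_part V d" using assms(1) step unfolding homogeneous_set_def by blast
  have "homogeneous_component (k - d) q \<in> polys V"
    using homogeneous_component_in[OF step(2)] homogeneous_part_polys by blast
  then show ?case using step ideal_gen.step[OF step(4)]
    by (auto simp: homogeneous_component_add homogeneous_component_mult[OF d])
qed (simp add: ideal_gen.zero)

section \<open>Hilbert series as dimension counts\<close>

text \<open>The Hilbert series of \<open>K[x\<^sub>v : v \<in> V] / I\<close>, with both dimensions taken in the space of all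
  polynomials: quotients by different ideals, even over different sets of variables, are then compared
  without leaving one vector space.  The subtraction takes place in the rationals, where it does not
  truncate.\<close>

definition hilbert_series :: "point set \<Rightarrow> 'k::field mpoly set \<Rightarrow> rat fps" where
  "hilbert_series V I = Abs_fps (\<lambda>k. of_nat (mpv.dim (homogeneous_part V k :: 'k mpoly set))
     - of_nat (mpv.dim (homogeneous_part V k \<inter> I)))"

text \<open>The dimension over the field of scalars inside the quotient ring is defined by successive line
  extensions.  A basis of \<open>H\<close> is added to \<open>H \<inter> I\<close> vector by vector; a vector outside the span so far has a
  residue class outside the image so far, and so contributes exactly one line extension.\<close>

lemma dim_graded_quotient:
  fixes I :: "'k::field mpoly set" and V :: "point set" and k :: nat
  assumes I: "ideal I (poly_ring V)" and one: "1 \<notin> I" and fin: "finite V" and sub: "mpv.subspace I"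
  defines "\<pi> \<equiv> \<lambda>p. I +>\<^bsub>poly_ring V\<^esub> p" and "H \<equiv> homogeneous_part V k"
  shows "ring.dim (poly_ring V Quot I) (\<pi> ` range const_poly) (\<pi> ` H) + mpv.dim (H \<inter> I)
     = mpv.dim H"
proof -
  let ?R = "poly_ring V :: ('k mpoly) ring" and ?Q = "poly_ring V Quot I"
  let ?F = "\<pi> ` range const_poly"
  interpret R: cring ?R by (rule cring_poly_ring)
  interpret I: ideal I ?R by (rule I)
  interpret Q: cring ?Q by (rule I.quotient_is_cring[OF R.is_cring])
  interpret h: ring_hom_ring ?R ?Q \<pi> unfolding \<pi>_def by (rule I.rcos_ring_hom_ring)
  have \<pi>_eq: "\<pi> a = \<pi> b \<longleftrightarrow> a - b \<in> I" if "a \<in> polys V" "b \<in> polys V" for a b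
    using R.quotient_eq_iff_same_a_r_cos[OF I that] poly_ring_minus[OF that] by (simp add: \<pi>_def)
  have F: "subfield ?F ?Q"
  proof (rule h.img_is_subfield(2))
    show "subfield (range const_poly) ?R"
    proof (rule R.subfieldI)
      have "subring (range const_poly) ?R"
      proof (rule R.subringI)
        fix h :: "'k mpoly" assume "h \<in> range const_poly"
        then obtain c where c: "h = const_poly c" by blast
        have "\<ominus>\<^bsub>?R\<^esub> h = const_poly (- c)"
          using c by (simp add: poly_ring_uminus) (simp add: const_poly_def single_uminus)
        then show "\<ominus>\<^bsub>?R\<^esub> h \<in> range const_poly" by blast
      qed (auto simp flip: const_poly_simps)
      then show "subcring (range const_poly) ?R" by (rule R.subcringI')
      show "Units (?R \<lparr>carrier := range const_poly\<rparr>) = range const_poly - {\<zero>\<^bsub>?R\<^esub>}"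
      proof -
        have 1: "const_poly c \<in> Units (?R \<lparr>carrier := range const_poly\<rparr>)" if "c \<noteq> 0" for c :: 'k
          unfolding Units_def using that
          by (auto intro!: exI[of _ "inverse c"] simp flip: const_poly_simps simp del: const_poly_simps(2))
        have 2: "const_poly c \<noteq> 0" if "c \<noteq> 0" for c :: 'k
          using that by (simp add: const_poly_def) (metis lookup_single_eq lookup_zero)
        have 3: "0 \<notin> Units (?R \<lparr>carrier := range const_poly\<rparr>)"
          unfolding Units_def by simp
        have 4: "Units (?R \<lparr>carrier := range const_poly\<rparr>) \<subseteq> range const_poly"
          unfolding Units_def by auto
        have "const_poly c \<in> Units (?R \<lparr>carrier := range const_poly\<rparr>) \<longleftrightarrow> c \<noteq> 0" for c :: 'k
          using 1[of c] 3 by (cases "c = 0") auto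
        then show ?thesis using 2 3 4 by auto
      qed
    qed
    show "\<one>\<^bsub>?Q\<^esub> \<noteq> \<zero>\<^bsub>?Q\<^esub>"
    proof -
      have "\<pi> 1 \<noteq> \<pi> 0" using \<pi>_eq[of 1 0] one by simp
      then show ?thesis using h.hom_one h.hom_zero by simp
    qed
  qed
  have subH: "mpv.subspace H" unfolding H_def by (rule subspace_homogeneous_part)
  have Hp: "H \<subseteq> polys V" unfolding H_def using homogeneous_part_polys by blast
  obtain B where B: "finite B" "H \<subseteq> mpv.span B"
    unfolding H_def by (rule homogeneous_part_finite_span[OF fin])
  have subHI: "mpv.subspace (H \<inter> I)" using mpv.subspace_inter subH sub by blast
  have chain: "\<exists>n. Q.dimension n ?F (\<pi> ` mpv.span (H \<inter> I \<union> T)) \<and>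
      n + mpv.dim (H \<inter> I) = mpv.dim (H \<inter> I \<union> T)" if "finite T" "T \<subseteq> H" for T
    using that
  proof (induction T rule: finite_induct)
    case empty
    have "mpv.span (H \<inter> I) = H \<inter> I" using subHI by (simp only: mpv.span_eq_iff)
    moreover have "\<pi> ` (H \<inter> I) = {\<zero>\<^bsub>?Q\<^esub>}"
    proof -
      have "\<pi> a = \<zero>\<^bsub>?Q\<^esub>" if "a \<in> H \<inter> I" for a
      proof -
        have "\<pi> a = \<pi> 0" using \<pi>_eq[of a 0] that Hp by auto
        then show ?thesis using h.hom_zero by simp
      qed
      moreover have "0 \<in> H \<inter> I" by (rule mpv.subspace_0[OF subHI])
      ultimately show ?thesis by (metis (no_types, lifting) image_cong image_constant)
    qed
    ultimately have "\<pi> ` mpv.span (H \<inter> I) = {\<zero>\<^bsub>?Q\<^esub>}" by (simp only:)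
    then have "Q.dimension 0 ?F (\<pi> ` mpv.span (H \<inter> I))" using Q.zero_dim by (simp only:)
    then show ?case by (intro exI[of _ 0]) (simp del: mpv.span_eq_iff)
  next
    case (insert v T)
    let ?W = "H \<inter> I \<union> T"
    have WH: "mpv.span ?W \<subseteq> H" using insert.prems subH by (intro mpv.span_minimal) auto
    have v: "v \<in> H" using insert.prems by blast
    obtain n where n: "Q.dimension n ?F (\<pi> ` mpv.span ?W)" "n + mpv.dim (H \<inter> I) = mpv.dim ?W"
      using insert by auto
    show ?case
    proof (cases "v \<in> mpv.span ?W")
      case True
      then have "mpv.span (H \<inter> I \<union> insert v T) = mpv.span ?W" using mpv.span_redundant by simp
      then show ?thesis using n mpv.dim_insert_in_span[OF True] by auto
    next
      case False
      have "\<pi> v \<notin> \<pi> ` mpv.span ?W"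
      proof
        assume "\<pi> v \<in> \<pi> ` mpv.span ?W"
        then obtain w where w: "w \<in> mpv.span ?W" "\<pi> v = \<pi> w" by blast
        then have "w \<in> H" using WH by blast
        then have "v - w \<in> I" using w \<pi>_eq v Hp by blast
        moreover have "v - w \<in> H" using v \<open>w \<in> H\<close> subH mpv.subspace_diff by blast
        ultimately have "v - w \<in> mpv.span ?W" by (simp add: mpv.span_base)
        then have "(v - w) + w \<in> mpv.span ?W" using w(1) mpv.span_add by blast
        then show False using False by simp
      qed
      moreover have "\<pi> v \<in> carrier ?Q" using v Hp by auto
      ultimately have "Q.dimension (Suc n) ?F (Q.line_extension ?F (\<pi> v) (\<pi> ` mpv.span ?W))"
        using Q.Suc_dim n(1) by blast
      moreover have "Q.line_extension ?F (\<pi> v) (\<pi> ` mpv.span ?W) = \<pi> ` mpv.span (insert v ?W)"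
      proof -
        have *: "\<pi> (const_poly c) \<otimes>\<^bsub>?Q\<^esub> \<pi> v \<oplus>\<^bsub>?Q\<^esub> \<pi> w = \<pi> (const_poly c * v + w)"
          if "w \<in> mpv.span ?W" for c w
        proof -
          have "w \<in> polys V" "v \<in> polys V" "const_poly c * v \<in> polys V"
            using that v WH Hp by (auto intro!: polys_mult)
          then show ?thesis using h.hom_mult[of "const_poly c" v] h.hom_add[of "const_poly c * v" w] by simp
        qed
        show ?thesis
        proof (rule equalityI; rule subsetI)
          fix u assume "u \<in> Q.line_extension ?F (\<pi> v) (\<pi> ` mpv.span ?W)"
          then obtain c w where cw: "w \<in> mpv.span ?W"
            "u = \<pi> (const_poly c) \<otimes>\<^bsub>?Q\<^esub> \<pi> v \<oplus>\<^bsub>?Q\<^esub> \<pi> w"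
            unfolding Q.line_extension_mem_iff by blast
          have "const_poly c * v + w \<in> mpv.span (insert v ?W)"
            using cw(1) unfolding mpv.span_insert by (auto intro!: exI[of _ c])
          then show "u \<in> \<pi> ` mpv.span (insert v ?W)" using cw * by auto
        next
          fix u assume "u \<in> \<pi> ` mpv.span (insert v ?W)"
          then obtain x c where x: "u = \<pi> x" "x - const_poly c * v \<in> mpv.span ?W"
            unfolding mpv.span_insert by blast
          then have "u = \<pi> (const_poly c) \<otimes>\<^bsub>?Q\<^esub> \<pi> v \<oplus>\<^bsub>?Q\<^esub> \<pi> (x - const_poly c * v)"
            using *[of "x - const_poly c * v" c] by simp
          then show "u \<in> Q.line_extension ?F (\<pi> v) (\<pi> ` mpv.span ?W)"
            using x(2) unfolding Q.line_extension_mem_iff by blast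
        qed
      qed
      moreover have "mpv.dim (insert v ?W) = Suc (mpv.dim ?W)"
        using mpv.dim_insert_outside_span[OF B(1) _ False] B(2) insert.prems by auto
      ultimately show ?thesis using n(2) by (intro exI[of _ "Suc n"]) simp
    qed
  qed
  obtain T where T: "T \<subseteq> H" "mpv.independent T" "H \<subseteq> mpv.span T"
    using mpv.basis_exists[of H] by metis
  have finT: "finite T" using mpv.independent_span_bound[OF B(1) T(2)] T(1) B(2) by blast
  have span: "mpv.span (H \<inter> I \<union> T) = H"
  proof (rule antisym)
    show "mpv.span (H \<inter> I \<union> T) \<subseteq> H" using subH T by (intro mpv.span_minimal) auto
    show "H \<subseteq> mpv.span (H \<inter> I \<union> T)" using T(3) mpv.span_mono[of T "H \<inter> I \<union> T"] by blast
  qed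
  obtain n where n: "Q.dimension n ?F (\<pi> ` H)" "n + mpv.dim (H \<inter> I) = mpv.dim (H \<inter> I \<union> T)"
    using chain[OF finT T(1)] span by auto
  have "mpv.dim (H \<inter> I \<union> T) = mpv.dim H"
    by (metis mpv.dim_span span)
  then show ?thesis using n Q.dimI[OF F n(1)] by (simp add: over_def)
qed

lemma inner_minors_homogeneous:
  assumes "g \<in> inner_minors S" shows "g \<in> homogeneous_part (vertices S) 2"
proof -
  obtain i j k l where ijkl: "inner_interval S (i, j) (k, l)"
    and g: "g = var (i, j) * var (k, l) - var (i, l) * var (k, j)"
    using assms unfolding inner_minors_def by blast
  have lt: "i < k" "j < l" using ijkl by (auto simp: inner_interval_def proper_interval_def)
  have cells: "cell (a, b) \<in> S" if "i \<le> a" "a < k" "j \<le> b" "b < l" for a b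
    using ijkl that by (auto simp: inner_interval_def cell_def)
  have mem: "(a, b) \<in> cell (a, b)" "(a + 1, b) \<in> cell (a, b)" "(a, b + 1) \<in> cell (a, b)"
    "(a + 1, b + 1) \<in> cell (a, b)" for a b
    by (auto simp: cell_def)
  have "(i, j) \<in> vertices S" "(k, j) \<in> vertices S" "(i, l) \<in> vertices S" "(k, l) \<in> vertices S"
    unfolding vertices_def
    using cells[of i j] cells[of "k - 1" j] cells[of i "l - 1"] cells[of "k - 1" "l - 1"] lt
      mem(1)[of i j] mem(2)[of "k - 1" j] mem(3)[of i "l - 1"] mem(4)[of "k - 1" "l - 1"] by auto
  then show ?thesis
    using homogeneous_mult[OF homogeneous_var homogeneous_var, of _ "vertices S"] g
    by (auto intro!: homogeneous_diff simp: numeral_2_eq_2)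
qed

lemma inner_minors_polys: "inner_minors S \<subseteq> polys (vertices S)"
  using inner_minors_homogeneous homogeneous_part_polys by blast

text \<open>The condition \<open>1 \<noteq> 0\<close> in the coordinate ring, without which the scalars would not form a field, holds
  because inner minors are quadratic.\<close>

lemma HP_eq_hilbert_series:
  assumes "finite (vertices S)"
  shows "HP TYPE('k::field) S =
    hilbert_series (vertices S) (ideal_gen (vertices S) (inner_minors S :: 'k mpoly set))"
proof -
  let ?V = "vertices S" and ?I = "ideal_gen (vertices S) (inner_minors S :: 'k mpoly set)"
  have I: "polyomino_ideal S = ?I"
    unfolding polyomino_ideal_def by (rule genideal_eq_ideal_gen[OF inner_minors_polys])
  have "1 \<notin> ?I"
  proof
    assume "1 \<in> ?I"
    then have "2 \<le> total_degree 0"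
    proof (rule ideal_gen_degree_ge)
      fix g m assume "g \<in> (inner_minors S :: 'k mpoly set)" "m \<in> Poly_Mapping.keys g"
      then show "2 \<le> total_degree m"
        using inner_minors_homogeneous[of g S] by (auto simp: homogeneous_part_iff)
    qed simp
    then show False by (simp add: total_degree_def)
  qed
  then have dim: "ring.dim (poly_ring ?V Quot ?I) (residue_class S ` range const_poly)
     (residue_class S ` homogeneous_part ?V k) + mpv.dim (homogeneous_part ?V k \<inter> ?I)
     = mpv.dim (homogeneous_part ?V k :: 'k mpoly set)" for k
    unfolding I
    by (rule dim_graded_quotient[OF ideal_ideal_gen[OF inner_minors_polys] _ assms subspace_ideal_gen])
  have "of_nat (ring.dim (coordinate_ring S :: ('k mpoly set) ring) (scalars S) (graded_component S k))
      = (of_nat (mpv.dim (homogeneous_part ?V k :: 'k mpoly set)) - of_nat (mpv.dim (homogeneous_part ?V k \<inter> ?I)) :: rat)" for k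
    unfolding dim[of k, symmetric] coordinate_ring_def scalars_def graded_component_def I
    by (simp flip: of_nat_add)
  then show ?thesis unfolding HP_def hilbert_poincare_def hilbert_series_def by simp
qed

section \<open>Substitution homomorphisms\<close>

definition monomial_value :: "(point \<Rightarrow> 'k::field mpoly) \<Rightarrow> (point \<Rightarrow>\<^sub>0 nat) \<Rightarrow> 'k mpoly" where
  "monomial_value h m = (\<Prod>v\<in>Poly_Mapping.keys m. h v ^ Poly_Mapping.lookup m v)"

definition subst :: "(point \<Rightarrow> 'k::field mpoly) \<Rightarrow> 'k mpoly \<Rightarrow> 'k mpoly" where
  "subst h p = (\<Sum>m\<in>Poly_Mapping.keys p. const_poly (Poly_Mapping.lookup p m) * monomial_value h m)"

lemma monomial_value_superset:
  assumes "finite A" "Poly_Mapping.keys m \<subseteq> A"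
  shows "monomial_value h m = (\<Prod>v\<in>A. h v ^ Poly_Mapping.lookup m v)"
  unfolding monomial_value_def
  by (rule prod.mono_neutral_left) (use assms in \<open>auto simp: in_keys_iff\<close>)

lemma monomial_value_add: "monomial_value h (m + n) = monomial_value h m * monomial_value h n"
  by (simp add: monomial_value_superset[of "Poly_Mapping.keys m \<union> Poly_Mapping.keys n"]
      keys_add_nat lookup_add power_add prod.distrib)

lemma monomial_value_var: "monomial_value var m = Poly_Mapping.single m (1::'a::field)"
proof -
  have pow: "var v ^ n = Poly_Mapping.single (Poly_Mapping.single v n) 1" for v n
    by (induction n) (auto simp: var_def mult_single simp flip: single_add)
  have 1: "(\<Prod>v\<in>A. Poly_Mapping.single (f v) (1::'a)) = Poly_Mapping.single (\<Sum>v\<in>A. f v) 1"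
    if "finite A" for A :: "point set" and f :: "point \<Rightarrow> (point \<Rightarrow>\<^sub>0 nat)"
    using that by (induction rule: finite_induct) (auto simp: mult_single)
  have 2: "m = (\<Sum>v\<in>Poly_Mapping.keys m. Poly_Mapping.single v (Poly_Mapping.lookup m v))"
    by (rule poly_mapping_eqI) (simp add: lookup_sum lookup_single when_def in_keys_iff)
  show ?thesis unfolding monomial_value_def pow 1[OF finite_keys] 2[symmetric] ..
qed

text \<open>Substitutions are ring homomorphisms, so identities and congruences between them need to be checked
  on constants and variables only; this rule is the reduction.\<close>

lemma polys_induct [consumes 1, case_names const var add mult]:
  fixes p :: "'k::field mpoly"
  assumes "p \<in> polys V" and const: "\<And>c. P (const_poly c)" and var: "\<And>v. v \<in> V \<Longrightarrow> P (var v)"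
    and add: "\<And>p q. p \<in> polys V \<Longrightarrow> q \<in> polys V \<Longrightarrow> P p \<Longrightarrow> P q \<Longrightarrow> P (p + q)"
    and mult: "\<And>p q. p \<in> polys V \<Longrightarrow> q \<in> polys V \<Longrightarrow> P p \<Longrightarrow> P q \<Longrightarrow> P (p * q)"
  shows "P p"
proof -
  have pow: "P (var v ^ n) \<and> (var v ^ n :: 'k mpoly) \<in> polys V" if "v \<in> V" for v n
  proof (induction n)
    case (Suc n)
    then show ?case using mult[of "var v" "var v ^ n"] var[OF that] that by (auto intro: polys_mult)
  qed (use const[of 1] in simp)
  have prod: "P (\<Prod>v\<in>A. var v ^ f v) \<and> ((\<Prod>v\<in>A. var v ^ f v) :: 'k mpoly) \<in> polys V"
    if "finite A" "A \<subseteq> V" for A f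
    using that const[of 1] pow by (induction rule: finite_induct) (auto intro: mult polys_mult)
  have "P p \<and> p \<in> polys V"
  proof (induction p rule: mpoly_induct)
    case zero
    then show ?case using const[of 0] by simp
  next
    case (single m)
    have m: "Poly_Mapping.keys m \<subseteq> V" using assms(1) single polys_iff by blast
    have "Poly_Mapping.single m (Poly_Mapping.lookup p m)
        = const_poly (Poly_Mapping.lookup p m) * monomial_value var m"
      by (simp add: monomial_value_var const_times_single)
    then show ?case
      unfolding monomial_value_def
      using mult[OF _ _ const] prod[OF finite_keys m] by (simp add: polys_mult)
  next
    case (add p q)
    then show ?case using assms(4) polys_add by blast
  qed
  then show ?thesis by blast
qed

lemma subst_superset:
  assumes "finite M" "Poly_Mapping.keys p \<subseteq> M"
  shows "subst h p = (\<Sum>m\<in>M. const_poly (Poly_Mapping.lookup p m) * monomial_value h m)"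
  unfolding subst_def
  by (rule sum.mono_neutral_left) (use assms in \<open>auto simp: in_keys_iff\<close>)

lemma subst_zero [simp]: "subst h 0 = 0"
  by (simp add: subst_def)

lemma subst_add: "subst h (p + q) = subst h p + subst h q"
  by (simp add: subst_superset[of "Poly_Mapping.keys p \<union> Poly_Mapping.keys q"]
      keys_add lookup_add sum.distrib algebra_simps)

lemma subst_single: "subst h (Poly_Mapping.single m c) = const_poly c * monomial_value h m"
  by (simp add: subst_superset[of "{m}"])

lemma subst_const [simp]: "subst h (const_poly c) = const_poly c"
  using subst_single[of h 0 c] by (simp add: monomial_value_def const_poly_def)

lemma subst_var [simp]: "subst h (var v) = h v"
  by (simp add: var_def subst_single monomial_value_def)

lemma subst_mult: "subst h (p * q) = subst h p * subst h q"
proof (induction p rule: mpoly_induct)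
  case (single m)
  let ?s = "Poly_Mapping.single m (Poly_Mapping.lookup p m)"
  show ?case
  proof (induction q rule: mpoly_induct)
    case (single n)
    then show ?case by (simp add: mult_single subst_single monomial_value_add)
  qed (simp_all add: subst_add distrib_left)
qed (simp_all add: subst_add distrib_right)

lemma subst_uminus: "subst h (- p) = - subst h p"
  using subst_add[of h p "- p"] by (simp add: eq_neg_iff_add_eq_0 add.commute)

lemma subst_diff: "subst h (p - q) = subst h p - subst h q"
  using subst_add[of h p "- q"] by (simp add: subst_uminus)

lemma subst_polys:
  assumes "\<And>v. v \<in> V \<Longrightarrow> h v \<in> polys W" "p \<in> polys V"
  shows "subst h p \<in> polys W"
  using assms(2)
  by (induction p rule: polys_induct) (auto simp: assms(1) subst_add subst_mult polys_add polys_mult)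

lemma subst_homogeneous:
  assumes "\<And>v. v \<in> V \<Longrightarrow> h v \<in> homogeneous_part W 1" "p \<in> homogeneous_part V k"
  shows "subst h p \<in> homogeneous_part W k"
proof -
  have prod: "(\<Prod>v\<in>A. h v ^ f v) \<in> homogeneous_part W (\<Sum>v\<in>A. f v)" if "finite A" "A \<subseteq> V" for A f
    using that
  proof (induction rule: finite_induct)
    case empty
    then show ?case using homogeneous_const[of 1 W] by simp
  next
    case (insert v A)
    then show ?case using homogeneous_mult[OF homogeneous_power[OF assms(1)], of v] by simp
  qed
  show ?thesis
  proof (induction p rule: mpoly_induct)
    case (single m)
    then have m: "Poly_Mapping.keys m \<subseteq> V" "total_degree m = k"
      using assms(2) by (auto simp: homogeneous_part_iff polys_iff)
    show ?case
      unfolding subst_single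
      using homogeneous_mult[OF homogeneous_const prod[OF finite_keys m(1), of "Poly_Mapping.lookup m"]] m(2)
      by (simp add: monomial_value_def total_degree_def)
  qed (simp_all add: homogeneous_zero subst_add homogeneous_add)
qed

lemma linear_subst:
  "Vector_Spaces.linear (\<lambda>c p. const_poly c * p) (\<lambda>c p. const_poly c * p) (subst h)"
  by unfold_locales (simp_all add: subst_add subst_mult)

lemma subst_ideal_gen:
  assumes "a \<in> ideal_gen V G" "\<And>v. v \<in> V \<Longrightarrow> h v \<in> polys W"
    "\<And>g. g \<in> G \<Longrightarrow> subst h g \<in> ideal_gen W G'"
  shows "subst h a \<in> ideal_gen W G'"
  using assms(1)
proof (induction a rule: ideal_gen.induct)
  case (step r q g)
  then show ?case
    using assms subst_polys[OF assms(2) step(2)]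
    by (simp add: subst_add subst_mult ideal_gen_add ideal_gen_mult)
qed (simp add: ideal_gen.zero)

section \<open>Killing and renaming variables\<close>

text \<open>The substitution that kills the variables in \<open>D\<close> and renames the others by \<open>\<sigma>\<close> is a retraction onto
  \<open>K[W]\<close>, with the renaming by \<open>\<tau>\<close> as a section; \<open>\<sigma>\<close> and \<open>\<tau>\<close> are inverse bijections between \<open>V - D\<close>
  and \<open>W\<close>.  Both maps respect the ideals generated by \<open>G\<close> and \<open>G'\<close>.\<close>

locale variable_retraction =
  fixes V W D :: "point set" and \<sigma> \<tau> :: "point \<Rightarrow> point" and G G' :: "'k::field mpoly set"
  assumes finV: "finite V" and D: "D \<subseteq> V"
    and \<sigma>: "\<And>v. v \<in> V \<Longrightarrow> v \<notin> D \<Longrightarrow> \<sigma> v \<in> W \<and> \<tau> (\<sigma> v) = v"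
    and \<tau>: "\<And>v. v \<in> W \<Longrightarrow> \<tau> v \<in> V \<and> \<tau> v \<notin> D \<and> \<sigma> (\<tau> v) = v"
    and G: "G \<subseteq> polys V"
    and subst_G: "\<And>g. g \<in> G \<Longrightarrow> subst (\<lambda>v. if v \<in> D then 0 else var (\<sigma> v)) g \<in> ideal_gen W G'"
    and subst_G': "\<And>g. g \<in> G' \<Longrightarrow> subst (\<lambda>v. var (\<tau> v)) g \<in> ideal_gen V G"
begin

definition "retract = subst (\<lambda>v. if v \<in> D then 0 else var (\<sigma> v) :: 'k mpoly)"

definition "section_map = subst (\<lambda>v. var (\<tau> v) :: 'k mpoly)"

text \<open>The name anticipates \<open>mem_preimage_ideal_iff\<close>: the ideal generated by \<open>G\<close> and the killed variables is
  the preimage under \<open>retract\<close> of the ideal generated by \<open>G'\<close>.\<close>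

abbreviation "preimage_ideal \<equiv> ideal_gen V (G \<union> var ` D)"

lemmas retract_G = subst_G[folded retract_def] and section_map_G' = subst_G'[folded section_map_def]

lemma finW: "finite W"
proof (rule finite_surj)
  show "W \<subseteq> \<sigma> ` V" using \<tau> by (metis image_eqI subsetI)
qed (rule finV)

lemma retract_polys: "p \<in> polys V \<Longrightarrow> retract p \<in> polys W"
  unfolding retract_def by (rule subst_polys[of V]) (use \<sigma> in auto)

lemma section_map_polys: "p \<in> polys W \<Longrightarrow> section_map p \<in> polys V"
  unfolding section_map_def by (rule subst_polys[of W]) (use \<tau> in auto)

lemma retract_section_map: "p \<in> polys W \<Longrightarrow> retract (section_map p) = p"
  by (induction p rule: polys_induct)
    (auto simp: retract_def section_map_def subst_add subst_mult \<tau>)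

text \<open>Killing and embedding back changes a polynomial only by multiples of killed variables, as one sees
  on variables.\<close>

lemma section_map_retract_cong: "p \<in> polys V \<Longrightarrow> p - section_map (retract p) \<in> ideal_gen V (var ` D)"
proof (induction p rule: polys_induct)
  case (var v)
  show ?case
  proof (cases "v \<in> D")
    case True
    then show ?thesis by (auto simp: retract_def section_map_def intro: ideal_gen_base)
  next
    case False
    then show ?thesis using \<sigma>[OF var] by (simp add: retract_def section_map_def ideal_gen.zero)
  qed
next
  case (add p q)
  then have "(p - section_map (retract p)) + (q - section_map (retract q)) \<in> ideal_gen V (var ` D)" by (simp add: ideal_gen_add)
  moreover have "(p - section_map (retract p)) + (q - section_map (retract q)) = (p + q) - section_map (retract (p + q))"
    by (simp add: retract_def section_map_def subst_add)
  ultimately show ?case by simp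
next
  case (mult p q)
  then have "p * (q - section_map (retract q)) + (p - section_map (retract p)) * section_map (retract q) \<in> ideal_gen V (var ` D)"
    by (intro ideal_gen_add ideal_gen_mult ideal_gen_mult2 section_map_polys retract_polys)
  moreover have "p * (q - section_map (retract q)) + (p - section_map (retract p)) * section_map (retract q) = p * q - section_map (retract (p * q))"
    by (simp add: retract_def section_map_def subst_mult algebra_simps)
  ultimately show ?case by simp
qed (simp add: retract_def section_map_def ideal_gen.zero)

lemma retract_ideal: "p \<in> ideal_gen V G \<Longrightarrow> retract p \<in> ideal_gen W G'"
  using subst_ideal_gen[of p V G _ W G'] retract_G \<sigma> unfolding retract_def by auto

lemma section_map_ideal: "p \<in> ideal_gen W G' \<Longrightarrow> section_map p \<in> ideal_gen V G"
  using subst_ideal_gen[of p W G' _ V G] section_map_G' \<tau> unfolding section_map_def by auto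

text \<open>From right to left, \<open>p\<close> differs from \<open>section_map (retract p)\<close> by a multiple of killed variables, and the
  latter lies in the ideal generated by \<open>G\<close>.\<close>

lemma mem_preimage_ideal_iff: "p \<in> polys V \<Longrightarrow> p \<in> preimage_ideal \<longleftrightarrow> retract p \<in> ideal_gen W G'"
proof
  assume "p \<in> preimage_ideal"
  then show "retract p \<in> ideal_gen W G'"
    unfolding retract_def
  proof (rule subst_ideal_gen)
    fix g assume "g \<in> G \<union> var ` D"
    then show "subst (\<lambda>v. if v \<in> D then 0 else var (\<sigma> v)) g \<in> ideal_gen W G'"
      using retract_G unfolding retract_def by (auto simp: ideal_gen.zero)
  qed (use \<sigma> in auto)
next
  assume p: "p \<in> polys V" and "retract p \<in> ideal_gen W G'"
  then have "section_map (retract p) \<in> preimage_ideal"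
    using section_map_ideal ideal_gen_mono[of G "G \<union> var ` D" V] by blast
  moreover have "p - section_map (retract p) \<in> preimage_ideal"
    using section_map_retract_cong[OF p] ideal_gen_mono[of "var ` D" "G \<union> var ` D" V] by blast
  ultimately have "(p - section_map (retract p)) + section_map (retract p) \<in> preimage_ideal" by (rule ideal_gen_add[rotated])
  then show "p \<in> preimage_ideal" by simp
qed

text \<open>The ideal generated by \<open>G'\<close> is the contraction along \<open>section_map\<close> of the ideal generated by \<open>G\<close>, so it inherits
  primality, and its preimage under \<open>retract\<close> inherits it in turn.\<close>

lemma prime_preimage_ideal:
  assumes prime: "\<And>a b. a \<in> polys V \<Longrightarrow> b \<in> polys V \<Longrightarrow> a * b \<in> ideal_gen V G \<Longrightarrow>
    a \<in> ideal_gen V G \<or> b \<in> ideal_gen V G"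
    and a: "a \<in> polys V" and b: "b \<in> polys V" and ab: "a * b \<in> preimage_ideal"
  shows "a \<in> preimage_ideal \<or> b \<in> preimage_ideal"
proof -
  have "retract (a * b) \<in> ideal_gen W G'" using mem_preimage_ideal_iff a b ab polys_mult by blast
  then have "section_map (retract a) * section_map (retract b) \<in> ideal_gen V G"
    using section_map_ideal[of "retract (a * b)"] by (simp add: retract_def section_map_def subst_mult)
  then have "section_map (retract a) \<in> ideal_gen V G \<or> section_map (retract b) \<in> ideal_gen V G"
    using prime a b retract_polys section_map_polys by blast
  then have "retract (section_map (retract a)) \<in> ideal_gen W G' \<or> retract (section_map (retract b)) \<in> ideal_gen W G'"
    using retract_ideal by blast
  then show ?thesis using retract_section_map retract_polys a b mem_preimage_ideal_iff by simp
qed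

lemma retract_homogeneous: "p \<in> homogeneous_part V k \<Longrightarrow> retract p \<in> homogeneous_part W k"
  unfolding retract_def
  by (rule subst_homogeneous[of V]) (use \<sigma> in \<open>auto simp: homogeneous_zero homogeneous_var[simplified]\<close>)

lemma section_map_homogeneous: "p \<in> homogeneous_part W k \<Longrightarrow> section_map p \<in> homogeneous_part V k"
  unfolding section_map_def
  by (rule subst_homogeneous[of W]) (use \<tau> in \<open>auto simp: homogeneous_var[simplified]\<close>)

lemma hilbert_series_preimage_ideal: "hilbert_series V preimage_ideal = hilbert_series W (ideal_gen W G')"
proof -
  have eq: "mpv.dim (homogeneous_part V k :: 'k mpoly set) + mpv.dim (homogeneous_part W k \<inter> ideal_gen W G')
     = mpv.dim (homogeneous_part W k :: 'k mpoly set) + mpv.dim (homogeneous_part V k \<inter> preimage_ideal)" for k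
  proof -
    obtain F1 where F1: "finite F1" "(homogeneous_part V k :: 'k mpoly set) \<subseteq> mpv.span F1"
      using homogeneous_part_finite_span[OF finV] by metis
    obtain F2 where F2: "finite F2" "(homogeneous_part W k :: 'k mpoly set) \<subseteq> mpv.span F2"
      using homogeneous_part_finite_span[OF finW] by metis
    show ?thesis
    proof (rule mpv2.codim_transfer[of retract, OF _ F1 F2])
      show "Vector_Spaces.linear (\<lambda>c p. const_poly c * p) (\<lambda>c p. const_poly c * p) retract"
        unfolding retract_def by (rule linear_subst)
      show "homogeneous_part V k \<inter> preimage_ideal = {a \<in> homogeneous_part V k. retract a \<in> homogeneous_part W k \<inter> ideal_gen W G'}"
        using mem_preimage_ideal_iff retract_homogeneous homogeneous_part_polys by blast
      show "retract ` homogeneous_part V k \<subseteq> homogeneous_part W k" using retract_homogeneous by blast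
      show "\<exists>a\<in>homogeneous_part V k. b - retract a \<in> homogeneous_part W k \<inter> ideal_gen W G'"
        if "b \<in> homogeneous_part W k" for b
        using that retract_section_map[OF homogeneous_part_polys[OF that]]
        by (intro bexI[of _ "section_map b"]) (auto simp: section_map_homogeneous homogeneous_zero ideal_gen.zero)
      show "mpv.subspace (homogeneous_part V k \<inter> preimage_ideal)"
        by (intro mpv.subspace_inter subspace_homogeneous_part subspace_ideal_gen)
      show "mpv.subspace (homogeneous_part W k \<inter> ideal_gen W G')"
        by (intro mpv.subspace_inter subspace_homogeneous_part subspace_ideal_gen)
    qed (auto intro: subspace_homogeneous_part)
  qed
  show ?thesis
    unfolding hilbert_series_def
  proof (rule arg_cong[of _ _ Abs_fps], rule ext)
    fix k
    have "of_nat (mpv.dim (homogeneous_part V k :: 'k mpoly set)) + of_nat (mpv.dim (homogeneous_part W k \<inter> ideal_gen W G'))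
     = (of_nat (mpv.dim (homogeneous_part W k :: 'k mpoly set)) + of_nat (mpv.dim (homogeneous_part V k \<inter> preimage_ideal)) :: rat)"
      by (simp only: of_nat_add[symmetric] eq[of k])
    then show "of_nat (mpv.dim (homogeneous_part V k :: 'k mpoly set)) - of_nat (mpv.dim (homogeneous_part V k \<inter> preimage_ideal))
      = (of_nat (mpv.dim (homogeneous_part W k :: 'k mpoly set)) - of_nat (mpv.dim (homogeneous_part W k \<inter> ideal_gen W G')) :: rat)"
      by (simp add: algebra_simps)
  qed
qed

text \<open>The colon ideal of an intermediate ideal by a surviving variable.  One inclusion is the
  hypothesis that \<open>var v\<close> moves each killed variable into the intermediate ideal; the other one is
  primality of \<open>preimage_ideal\<close>, which contains the intermediate ideal but not \<open>var v\<close>.\<close>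

lemma colon_preimage_ideal:
  assumes prime: "\<And>a b. a \<in> polys V \<Longrightarrow> b \<in> polys V \<Longrightarrow> a * b \<in> ideal_gen V G \<Longrightarrow>
    a \<in> ideal_gen V G \<or> b \<in> ideal_gen V G"
    and v: "v \<in> V" "v \<notin> D" "var (\<sigma> v) \<notin> ideal_gen W G'"
    and G0: "G \<subseteq> G0" "G0 \<subseteq> G \<union> var ` D"
    and vD: "\<And>d. d \<in> D \<Longrightarrow> var v * var d \<in> ideal_gen V G0"
    and f: "f \<in> polys V"
  shows "f \<in> preimage_ideal \<longleftrightarrow> var v * f \<in> ideal_gen V G0"
proof
  assume "f \<in> preimage_ideal"
  then show "var v * f \<in> ideal_gen V G0"
  proof (induction f rule: ideal_gen.induct)
    case (step r q g)
    have "var v * g \<in> ideal_gen V G0"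
    proof (cases "g \<in> G")
      case True
      then show ?thesis using G0(1) v(1) by (intro ideal_gen_mult ideal_gen_base) auto
    next
      case False
      then show ?thesis using step(3) vD by blast
    qed
    then have "var v * r + q * (var v * g) \<in> ideal_gen V G0"
      using step by (blast intro: ideal_gen_add ideal_gen_mult)
    then show ?case by (simp add: algebra_simps)
  qed (simp add: ideal_gen.zero)
next
  assume "var v * f \<in> ideal_gen V G0"
  then have "var v * f \<in> preimage_ideal" using ideal_gen_mono[OF G0(2)] by blast
  then have "var v \<in> preimage_ideal \<or> f \<in> preimage_ideal" using prime_preimage_ideal[OF prime _ f, of "var v"] v by simp
  moreover have "var v \<notin> preimage_ideal" using mem_preimage_ideal_iff[of "var v"] v by (simp add: retract_def)
  ultimately show "f \<in> preimage_ideal" by blast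
qed

end

section \<open>Adjoining a variable to an ideal\<close>

lemma ideal_gen_insertE:
  assumes "a \<in> ideal_gen V (insert x G)"
  obtains j q where "j \<in> ideal_gen V G" "q \<in> polys V" "a = j + q * x"
proof -
  have "\<exists>j q. j \<in> ideal_gen V G \<and> q \<in> polys V \<and> a = j + q * x"
    using assms
  proof (induction a rule: ideal_gen.induct)
    case zero
    show ?case by (intro exI[of _ 0]) (simp add: ideal_gen.zero)
  next
    case (step r q g)
    then obtain j q' where j: "j \<in> ideal_gen V G" "q' \<in> polys V" "r = j + q' * x" by blast
    show ?case
    proof (cases "g = x")
      case True
      have "r + q * g = j + (q' + q) * x" using True j by (simp add: algebra_simps)
      then show ?thesis using j step polys_add by blast
    next
      case False
      have "r + q * g = (j + q * g) + q' * x" using j by (simp add: algebra_simps)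
      moreover have "j + q * g \<in> ideal_gen V G" using False j step by (auto intro: ideal_gen.step)
      ultimately show ?thesis using j by blast
    qed
  qed
  then show ?thesis using that by blast
qed

text \<open>The Hilbert series of the exact sequence
  \<open>0 \<rightarrow> (S/X)(-1) \<rightarrow> S/I \<rightarrow> S/(I, x) \<rightarrow> 0\<close> given by multiplication by \<open>x\<close>, where \<open>X = I : x\<close>.  In degree
  \<open>k + 1\<close> it compares \<open>S\<^sub>k / X\<^sub>k\<close> with \<open>(I, x)\<^sub>k\<^sub>+\<^sub>1 / I\<^sub>k\<^sub>+\<^sub>1\<close>; homogeneity of \<open>I\<close> makes every form in
  \<open>(I, x)\<close> the sum of a form in \<open>I\<close> and \<open>x\<close> times a form.\<close>

lemma hilbert_series_colon:
  fixes G X :: "'k::field mpoly set"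
  assumes fin: "finite V" and hom: "homogeneous_set V G" and x: "x \<in> V"
    and X: "\<And>f. f \<in> polys V \<Longrightarrow> f \<in> X \<longleftrightarrow> var x * f \<in> ideal_gen V G"
  shows "hilbert_series V (ideal_gen V G) =
    fps_X * hilbert_series V X + hilbert_series V (ideal_gen V (insert (var x) G))"
proof (rule fps_ext)
  fix n
  let ?J = "ideal_gen V (insert (var x) G)"
  let ?H = "\<lambda>k. homogeneous_part V k :: 'k mpoly set"
  have GJ: "ideal_gen V G \<subseteq> ?J" by (rule ideal_gen_mono) blast
  have xh: "var x \<in> homogeneous_part V 1" using x by (rule homogeneous_var)
  have comp: "\<exists>j q. j \<in> ?H k \<and> j \<in> ideal_gen V G \<and> q \<in> polys V \<and>
      a = j + (if 1 \<le> k then homogeneous_component (k - 1) q * var x else 0)"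
    if aH: "a \<in> ?H k" and aJ: "a \<in> ?J" for a k
  proof -
    obtain j q where j: "j \<in> ideal_gen V G" "q \<in> polys V" "a = j + q * var x"
      using ideal_gen_insertE[OF aJ] by metis
    have "homogeneous_component k a = a" using homogeneous_component_homogeneous[OF aH] by simp
    then have "a = homogeneous_component k j + (if 1 \<le> k then homogeneous_component (k - 1) q * var x else 0)"
      using j(3) homogeneous_component_mult[OF xh, of k q] by (simp add: homogeneous_component_add)
    moreover have jG: "homogeneous_component k j \<in> ideal_gen V G"
      using homogeneous_component_ideal_gen[OF hom j(1)] .
    moreover have "homogeneous_component k j \<in> ?H k"
    proof -
      have "j \<in> polys V"
        using j(1)  hom homogeneous_part_polys ideal_gen_polys[of G V j] unfolding homogeneous_set_def by blast
      then show ?thesis by (rule homogeneous_component_in)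
    qed
    ultimately show ?thesis using j(2) by blast
  qed
  show "fps_nth (hilbert_series V (ideal_gen V G)) n =
    fps_nth (fps_X * hilbert_series V X + hilbert_series V ?J) n"
  proof (cases n)
    case 0
    have "?H 0 \<inter> ideal_gen V G = ?H 0 \<inter> ?J"
      using comp[of _ 0] GJ by auto
    then show ?thesis using 0 by (simp add: hilbert_series_def)
  next
    case (Suc k)
    obtain F1 where F1: "finite F1" "?H k \<subseteq> mpv.span F1"
      using homogeneous_part_finite_span[OF fin] by metis
    obtain F2 where F2: "finite F2" "?H (Suc k) \<subseteq> mpv.span F2"
      using homogeneous_part_finite_span[OF fin] by metis
    have xH: "var x * f \<in> ?H (Suc k)" if "f \<in> ?H k" for f
      using homogeneous_mult[OF xh that] by simp
    have xJ: "var x * f \<in> ?J" if "f \<in> ?H k" for f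
      using that homogeneous_part_polys by (blast intro: ideal_gen_mult2 ideal_gen_base)
    have "mpv.dim (?H k) + mpv.dim (?H (Suc k) \<inter> ideal_gen V G)
      = mpv.dim (?H (Suc k) \<inter> ?J) + mpv.dim (?H k \<inter> X)"
    proof (rule mpv2.codim_transfer[of "\<lambda>p. var x * p", OF _ F1 F2(1)])
      show "Vector_Spaces.linear (\<lambda>c p. const_poly c * p) (\<lambda>c p. const_poly c * p) (\<lambda>p. var x * p)"
        by unfold_locales (simp_all add: algebra_simps)
      show eq: "?H k \<inter> X = {a \<in> ?H k. var x * a \<in> ?H (Suc k) \<inter> ideal_gen V G}"
        using X xH homogeneous_part_polys by blast
      show "mpv.subspace (?H k \<inter> X)"
        unfolding eq
        by (auto simp: mpv.subspace_def homogeneous_zero ideal_gen.zero distrib_left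
            mult.left_commute[of "var x" "const_poly _"] mpv.subspace_scale[OF subspace_homogeneous_part]
            intro: homogeneous_add ideal_gen_add ideal_gen_mult)
      show "(\<lambda>p. var x * p) ` ?H k \<subseteq> ?H (Suc k) \<inter> ?J" using xH xJ by blast
      show "?H (Suc k) \<inter> ideal_gen V G \<subseteq> ?H (Suc k) \<inter> ?J" using GJ by blast
      show "\<exists>a\<in>?H k. b - var x * a \<in> ?H (Suc k) \<inter> ideal_gen V G" if b: "b \<in> ?H (Suc k) \<inter> ?J" for b
      proof -
        obtain j q where j: "j \<in> ?H (Suc k)" "j \<in> ideal_gen V G" "q \<in> polys V"
          "b = j + homogeneous_component k q * var x"
          using comp[of b "Suc k"] b by auto
        then show ?thesis
          by (intro bexI[of _ "homogeneous_component k q"]) (auto simp: homogeneous_component_in mult.commute)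
      qed
    qed (use F2 in \<open>auto intro!: mpv.subspace_inter subspace_homogeneous_part subspace_ideal_gen\<close>)
    note eq = this
    have "of_nat (mpv.dim (?H k)) + of_nat (mpv.dim (?H (Suc k) \<inter> ideal_gen V G))
      = (of_nat (mpv.dim (?H (Suc k) \<inter> ?J)) + of_nat (mpv.dim (?H k \<inter> X)) :: rat)"
      by (simp only: of_nat_add[symmetric] eq)
    then show ?thesis using Suc by (simp add: hilbert_series_def algebra_simps)
  qed
qed

section \<open>Free variables\<close>

text \<open>Division by \<open>x\<close>, with the terms not divisible by \<open>x\<close> dropped.  It is a left inverse of multiplication by
  \<open>x\<close> and linear over the polynomials in the other variables (\<open>divide_var_mult\<close>).\<close>

definition divide_var :: "point \<Rightarrow> 'k::field mpoly \<Rightarrow> 'k mpoly" where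
  "divide_var x p = Poly_Mapping.map_key (\<lambda>m. m + Poly_Mapping.single x 1) p"

lemma lookup_divide_var:
  "Poly_Mapping.lookup (divide_var x p) m = Poly_Mapping.lookup p (m + Poly_Mapping.single x 1)"
  unfolding divide_var_def by (subst map_key.rep_eq) (auto simp: inj_on_def)

lemma divide_var_zero [simp]: "divide_var x 0 = 0"
  by (rule poly_mapping_eqI) (simp add: lookup_divide_var)

lemma divide_var_add: "divide_var x (p + q) = divide_var x p + divide_var x q"
  by (rule poly_mapping_eqI) (simp add: lookup_divide_var lookup_add)

lemma divide_var_polys:
  assumes "p \<in> polys V" shows "divide_var x p \<in> polys V"
  unfolding polys_iff
proof
  fix m assume "m \<in> Poly_Mapping.keys (divide_var x p)"
  then have "m + Poly_Mapping.single x 1 \<in> Poly_Mapping.keys p"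
    by (simp add: in_keys_iff lookup_divide_var)
  then have "Poly_Mapping.keys (m + Poly_Mapping.single x 1) \<subseteq> V"
    using assms polys_iff by blast
  then show "Poly_Mapping.keys m \<subseteq> V" by (simp add: keys_add_nat)
qed

lemma divide_var_const_mult: "divide_var x (const_poly c * q) = const_poly c * divide_var x q"
  by (rule poly_mapping_eqI) (simp add: lookup_divide_var)

lemma lookup_var_times:
  "Poly_Mapping.lookup (var v * q) m =
    (if v \<in> Poly_Mapping.keys m then Poly_Mapping.lookup q (m - Poly_Mapping.single v 1) else 0)"
proof (induction q rule: mpoly_induct)
  case (single n)
  have *: "Poly_Mapping.single v 1 + n = m \<longleftrightarrow> v \<in> Poly_Mapping.keys m \<and> n = m - Poly_Mapping.single v 1"
  proof
    assume "Poly_Mapping.single v 1 + n = m"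
    then show "v \<in> Poly_Mapping.keys m \<and> n = m - Poly_Mapping.single v 1"
      by (auto simp: keys_add_nat)
  next
    assume "v \<in> Poly_Mapping.keys m \<and> n = m - Poly_Mapping.single v 1"
    then show "Poly_Mapping.single v 1 + n = m"
      by (intro poly_mapping_eqI) (auto simp: lookup_add lookup_minus lookup_single when_def in_keys_iff)
  qed
  show ?case using * by (auto simp: var_def mult_single lookup_single when_def)
qed (auto simp: lookup_add distrib_left)

lemma divide_var_times_var: "divide_var x (var x * q) = q"
  by (rule poly_mapping_eqI) (simp add: lookup_divide_var lookup_var_times keys_add_nat)

lemma divide_var_other_var:
  assumes "v \<noteq> x" shows "divide_var x (var v * q) = var v * divide_var x q"
proof (rule poly_mapping_eqI)
  fix m :: "point \<Rightarrow>\<^sub>0 nat"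
  have "m + Poly_Mapping.single x 1 - Poly_Mapping.single v 1 = m - Poly_Mapping.single v 1 + Poly_Mapping.single x 1"
    using assms by (intro poly_mapping_eqI) (auto simp: lookup_add lookup_minus lookup_single when_def)
  then show "Poly_Mapping.lookup (divide_var x (var v * q)) m = Poly_Mapping.lookup (var v * divide_var x q) m"
    using assms by (simp add: lookup_divide_var lookup_var_times keys_add_nat)
qed

lemma divide_var_mult:
  assumes "x \<notin> V" "g \<in> polys V"
  shows "divide_var x (g * q) = g * divide_var x q"
  using assms(2)
proof (induction g arbitrary: q rule: polys_induct)
  case (var v)
  then have "v \<noteq> x" using assms(1) by auto
  then show ?case by (rule divide_var_other_var)
qed (simp_all add: divide_var_const_mult divide_var_add distrib_right mult.assoc)

text \<open>A variable that does not occur in the generators is a nonzerodivisor modulo their ideal: division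
  by it maps the ideal to itself.\<close>

lemma var_times_mem_iff:
  assumes G: "G \<subseteq> polys V" and x: "x \<notin> V" and f: "f \<in> polys (insert x V)"
  shows "var x * f \<in> ideal_gen (insert x V) G \<longleftrightarrow> f \<in> ideal_gen (insert x V) G"
proof
  have "divide_var x a \<in> ideal_gen (insert x V) G" if "a \<in> ideal_gen (insert x V) G" for a
    using that
  proof (induction a rule: ideal_gen.induct)
    case (step r q g)
    have "divide_var x (q * g) = divide_var x q * g"
      using divide_var_mult[OF x, of g q] step(3) G by (auto simp: mult.commute)
    then show ?case
      using step ideal_gen.step[OF step(4) divide_var_polys[OF step(2)] step(3)]
      by (simp add: divide_var_add)
  qed (simp add: ideal_gen.zero)
  then show "f \<in> ideal_gen (insert x V) G" if "var x * f \<in> ideal_gen (insert x V) G"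
    using that divide_var_times_var by metis
  show "var x * f \<in> ideal_gen (insert x V) G" if "f \<in> ideal_gen (insert x V) G"
    using that by (auto intro: ideal_gen_mult)
qed

lemma homogeneous_set_mono:
  "homogeneous_set V G \<Longrightarrow> V \<subseteq> W \<Longrightarrow> homogeneous_set W G"
  unfolding homogeneous_set_def homogeneous_part_iff using polys_mono by blast

lemma homogeneous_set_polys: "homogeneous_set V G \<Longrightarrow> G \<subseteq> polys V"
  unfolding homogeneous_set_def using homogeneous_part_polys by blast

text \<open>The colon ideal by a free variable is the ideal itself, and killing the variable leads back to the
  ring without it.\<close>

lemma hilbert_series_insert_free:
  fixes G :: "'k::field mpoly set"
  assumes fin: "finite V" and hom: "homogeneous_set V G" and x: "x \<notin> V"
  shows "hilbert_series (insert x V) (ideal_gen (insert x V) G) * (1 - fps_X) = hilbert_series V (ideal_gen V G)"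
proof -
  note G = homogeneous_set_polys[OF hom]
  interpret r: variable_retraction "insert x V" V "{x}" id id G G
  proof unfold_locales
    fix g assume g: "g \<in> G"
    then have gV: "g \<in> polys V" using G by blast
    then have "subst (\<lambda>v. if v \<in> {x} then 0 else var (id v)) g = g"
      by (induction g rule: polys_induct) (use x in \<open>auto simp: subst_add subst_mult\<close>)
    then show "subst (\<lambda>v. if v \<in> {x} then 0 else var (id v)) g \<in> ideal_gen V G"
      using ideal_gen_base[OF g] by (simp only:)
    from gV have "subst (\<lambda>v. var (id v)) g = g"
      by (induction g rule: polys_induct) (auto simp: subst_add subst_mult)
    then show "subst (\<lambda>v. var (id v)) g \<in> ideal_gen (insert x V) G"
      using ideal_gen_base[OF g] by (simp only:)
  qed (use fin x G polys_mono[of V "insert x V"] in auto)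
  have "hilbert_series (insert x V) (ideal_gen (insert x V) G) =
    fps_X * hilbert_series (insert x V) (ideal_gen (insert x V) G)
    + hilbert_series (insert x V) (ideal_gen (insert x V) (insert (var x) G))"
    using fin homogeneous_set_mono[OF hom] var_times_mem_iff[OF G x]
    by (intro hilbert_series_colon) auto
  also have "hilbert_series (insert x V) (ideal_gen (insert x V) (insert (var x) G)) = hilbert_series V (ideal_gen V G)"
    using r.hilbert_series_preimage_ideal by simp
  finally show ?thesis by (simp add: algebra_simps)
qed

lemma hilbert_series_free:
  fixes G :: "'k::field mpoly set"
  assumes fin: "finite V" and hom: "homogeneous_set V G" and F: "finite F" "F \<inter> V = {}"
  shows "hilbert_series (V \<union> F) (ideal_gen (V \<union> F) G) = hilbert_series V (ideal_gen V G) / (1 - fps_X) ^ card F"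
  using F
proof (induction F rule: finite_induct)
  case (insert x F)
  let ?h = "hilbert_series (V \<union> F) (ideal_gen (V \<union> F) G)"
  let ?h' = "hilbert_series (V \<union> insert x F) (ideal_gen (V \<union> insert x F) G)"
  have "?h' * (1 - fps_X) = ?h"
    using hilbert_series_insert_free[of "V \<union> F" G x] fin hom homogeneous_set_mono[OF hom, of "V \<union> F"] insert by auto
  also have "?h = hilbert_series V (ideal_gen V G) / (1 - fps_X) ^ card F" using insert by auto
  finally have "?h' * (1 - fps_X) / (1 - fps_X) = hilbert_series V (ideal_gen V G) / (1 - fps_X) ^ card F / (1 - fps_X)"
    by simp
  moreover have "?h' * (1 - fps_X) / (1 - fps_X) = ?h'" by simp
  moreover have "hilbert_series V (ideal_gen V G) / (1 - fps_X) ^ card F / (1 - fps_X)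
     = hilbert_series V (ideal_gen V G) / (1 - fps_X) ^ Suc (card F)"
    by (simp add: fps_divide_unit power_Suc2 fps_inverse_mult mult.assoc del: power_Suc)
  ultimately show ?case using insert by simp
qed simp

section \<open>Cells, vertices and inner intervals\<close>

lemma mem_cell_iff: "(p + (x, y)) \<in> cell (p + (m, n)) \<longleftrightarrow> (x = m \<or> x = m + 1) \<and> (y = n \<or> y = n + (1::int))"
  by (cases p) (auto simp: cell_def)

lemma cell_eq_iff: "cell u = cell v \<longleftrightarrow> u = v"
proof
  assume eq: "cell u = cell v"
  have "w \<in> cell w" for w by (cases w) (simp add: cell_def)
  then have "u \<in> cell u" "v \<in> cell v" by blast+
  then have "u \<in> cell v" "v \<in> cell u" using eq by auto
  then show "u = v" by (auto simp: cell_def)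
qed simp

lemma finite_cell: "finite (cell u)"
proof -
  have "cell u = {fst u..fst u + 1} \<times> {snd u..snd u + 1}"
    by (cases u) (auto simp: cell_def)
  then show ?thesis by simp
qed

lemma point_cases:
  fixes p v :: point
  obtains x y where "v = p + (x, y)"
proof (rule that)
  show "v = p + (fst (v - p), snd (v - p))" by (cases p; cases v) simp
qed

lemma vertices_iff:
  assumes "S \<subseteq> range cell"
  shows "p + (x, y) \<in> vertices S \<longleftrightarrow>
    cell (p + (x, y)) \<in> S \<or> cell (p + (x - 1, y)) \<in> S \<or> cell (p + (x, y - 1)) \<in> S \<or> cell (p + (x - 1, y - 1)) \<in> S"
proof
  assume "p + (x, y) \<in> vertices S"
  then obtain c where c: "c \<in> S" "p + (x, y) \<in> c" unfolding vertices_def by blast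
  then obtain u where u: "c = cell u" using assms by blast
  obtain m n where mn: "u = p + (m, n)" by (rule point_cases)
  have "m = x \<or> m = x - 1" "n = y \<or> n = y - 1" using c(2) unfolding u mn mem_cell_iff by auto
  then show "cell (p + (x, y)) \<in> S \<or> cell (p + (x - 1, y)) \<in> S \<or> cell (p + (x, y - 1)) \<in> S \<or> cell (p + (x - 1, y - 1)) \<in> S"
    using c(1) unfolding u mn by auto
next
  have "p + (x, y) \<in> cell (p + (x, y))" "p + (x, y) \<in> cell (p + (x - 1, y))"
    "p + (x, y) \<in> cell (p + (x, y - 1))" "p + (x, y) \<in> cell (p + (x - 1, y - 1))"
    unfolding mem_cell_iff by auto
  then show "cell (p + (x, y)) \<in> S \<or> cell (p + (x - 1, y)) \<in> S \<or> cell (p + (x, y - 1)) \<in> S \<or> cell (p + (x - 1, y - 1)) \<in> S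
    \<Longrightarrow> p + (x, y) \<in> vertices S"
    unfolding vertices_def by blast
qed

text \<open>The left-hand side says that one of the four cells having \<open>(x, y)\<close> as a corner lies in a horizontal
  strip of cells.  Exchanging \<open>x\<close> and \<open>y\<close> gives the same fact for vertical strips.\<close>

lemma strip_vertices:
  fixes lo hi x y :: int
  assumes "lo \<le> hi"
  shows "(y = 0 \<and> lo \<le> x \<and> x \<le> hi) \<or> (y = 0 \<and> lo \<le> x - 1 \<and> x - 1 \<le> hi) \<or>
      (y - 1 = 0 \<and> lo \<le> x \<and> x \<le> hi) \<or> (y - 1 = 0 \<and> lo \<le> x - 1 \<and> x - 1 \<le> hi)
    \<longleftrightarrow> (y = 0 \<or> y = 1) \<and> lo \<le> x \<and> x \<le> hi + 1"
proof -
  have "lo \<le> x \<and> x \<le> hi \<or> lo \<le> x - 1 \<and> x - 1 \<le> hi \<longleftrightarrow> lo \<le> x \<and> x \<le> hi + 1"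
    using assms by linarith
  moreover have "y - 1 = 0 \<longleftrightarrow> y = 1" by linarith
  ultimately show ?thesis by metis
qed

lemma inner_interval_iff:
  "inner_interval S (p + (i, j)) (p + (k, l)) \<longleftrightarrow>
    i < k \<and> j < l \<and> (\<forall>m n. i \<le> m \<and> m < k \<and> j \<le> n \<and> n < l \<longrightarrow> cell (p + (m, n)) \<in> S)"
proof -
  have sub: "cell (p + (m, n)) \<subseteq> {p + (i, j)..p + (k, l)} \<longleftrightarrow> i \<le> m \<and> m < k \<and> j \<le> n \<and> n < l" for m n
    by (cases p) (auto simp: cell_def)
  have "(\<forall>w. cell w \<subseteq> {p + (i, j)..p + (k, l)} \<longrightarrow> cell w \<in> S) \<longleftrightarrow>
    (\<forall>m n. cell (p + (m, n)) \<subseteq> {p + (i, j)..p + (k, l)} \<longrightarrow> cell (p + (m, n)) \<in> S)"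
    by (metis point_cases)
  then show ?thesis unfolding inner_interval_def sub by (cases p) (auto simp: proper_interval_def)
qed

text \<open>Arguments: two columns, then two rows.  No order is imposed on them, since exchanging two columns or
  two rows only changes the sign (\<open>minor_ideal_gen\<close>); this makes the argument independent of the side on
  which a bar is attached.\<close>

definition minor :: "point \<Rightarrow> int \<Rightarrow> int \<Rightarrow> int \<Rightarrow> int \<Rightarrow> 'k::field mpoly" where
  "minor p i k j l = var (p + (i, j)) * var (p + (k, l)) - var (p + (i, l)) * var (p + (k, j))"

lemma inner_minors_eq: "inner_minors S = {minor p i k j l |i k j l. inner_interval S (p + (i, j)) (p + (k, l))}"
proof (rule equalityI; rule subsetI)
  fix g :: "'a mpoly" assume "g \<in> inner_minors S"
  then obtain i j k l where g: "g = var (i, j) * var (k, l) - var (i, l) * var (k, j)"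
    and S: "inner_interval S (i, j) (k, l)" unfolding inner_minors_def by blast
  have "g = minor p (i - fst p) (k - fst p) (j - snd p) (l - snd p)"
    by (cases p) (simp add: minor_def g)
  moreover have "inner_interval S (p + (i - fst p, j - snd p)) (p + (k - fst p, l - snd p))"
    using S by (cases p) simp
  ultimately show "g \<in> {minor p i k j l |i k j l. inner_interval S (p + (i, j)) (p + (k, l))}" by blast
next
  fix g :: "'a mpoly" assume "g \<in> {minor p i k j l |i k j l. inner_interval S (p + (i, j)) (p + (k, l))}"
  then obtain i j k l where g: "g = minor p i k j l"
    and S: "inner_interval S (p + (i, j)) (p + (k, l))" by blast
  obtain a b where p: "p = (a, b)" by (cases p)
  have "inner_interval S (a + i, b + j) (a + k, b + l)" using S by (simp add: p)
  moreover have "g = var (a + i, b + j) * var (a + k, b + l) - var (a + i, b + l) * var (a + k, b + j)"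
    by (simp add: g minor_def p)
  ultimately show "g \<in> inner_minors S" unfolding inner_minors_def by blast
qed

lemma minor_ideal_gen:
  assumes "i \<noteq> k \<Longrightarrow> j \<noteq> l \<Longrightarrow> inner_interval S (p + (min i k, min j l)) (p + (max i k, max j l))"
  shows "minor p i k j l \<in> ideal_gen V (inner_minors S)"
proof (cases "i = k \<or> j = l")
  case True
  then show ?thesis by (auto simp: minor_def ideal_gen.zero)
next
  case False
  let ?m = "minor p (min i k) (max i k) (min j l) (max j l) :: 'a mpoly"
  have "?m \<in> ideal_gen V (inner_minors S)"
    using assms False unfolding inner_minors_eq[of S p] by (blast intro: ideal_gen_base)
  moreover have "minor p i k j l = ?m \<or> minor p i k j l = - ?m"
    by (auto simp: minor_def min_def max_def algebra_simps)
  ultimately show ?thesis using ideal_gen_uminus by metis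
qed

section \<open>Inner intervals of an (L,C)-polyomino\<close>

text \<open>An inner interval that contains a cell \<open>(a, 0)\<close> of the horizontal bar.  The cells next to the ends of
  the bars cannot lie in \<open>\<C>\<close>, because they would share both vertices of a short edge with \<open>\<L>\<close>,
  while \<open>\<C>\<close> meets only one row and one column of the bars.  Likewise a cell above or below the bar lies in \<open>\<C>\<close> only at
  \<open>a = r\<close>, and only on the attached side.  Thus an interval of height more than one has width one, and
  its cells lie in the vertical bar or pass through \<open>A\<^sub>r\<close>.\<close>

lemma box_through_row:
  fixes r s xw yw i j k l a :: int and inC :: "int \<Rightarrow> int \<Rightarrow> bool"
  defines "inP \<equiv> \<lambda>m n. (n = 0 \<and> 0 \<le> m \<and> m \<le> r) \<or> (m = 0 \<and> 0 \<le> n \<and> n \<le> s) \<or> inC m n"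
  assumes rs: "2 \<le> r" "2 \<le> s" 
    and attach: "\<And>x y. (0 \<le> x \<and> x \<le> r + 1 \<and> 0 \<le> y \<and> y \<le> 1) \<or> (0 \<le> x \<and> x \<le> 1 \<and> 0 \<le> y \<and> y \<le> s + 1) \<Longrightarrow>
      inC x y \<or> inC (x - 1) y \<or> inC x (y - 1) \<or> inC (x - 1) (y - 1) \<Longrightarrow>
      (x = xw \<and> (y = s \<or> y = s + 1)) \<or> (y = yw \<and> (x = r \<or> x = r + 1))"
    and box: "\<And>m n. i \<le> m \<Longrightarrow> m < k \<Longrightarrow> j \<le> n \<Longrightarrow> n < l \<Longrightarrow> inP m n"
    and a: "i \<le> a" "a < k" "j \<le> 0" "0 < l" "0 \<le> a" "a \<le> r"
  shows "(j = 0 \<and> l = 1 \<and> 0 \<le> i \<and> k \<le> r + 1) \<or> (i = 0 \<and> k = 1 \<and> 0 \<le> j \<and> l \<le> s + 1) \<or>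
    (i = r \<and> k = r + 1 \<and> (j = 0 \<and> 2 \<le> l \<and> yw = 1 \<or> j < 0 \<and> l = 1 \<and> yw = 0))"
proof -
  have left: "\<not> inP (- 1) 0" using attach[of 0 0] rs unfolding inP_def by auto
  have right: "\<not> inP (r + 1) 0" using attach[of "r + 1" 0] attach[of "r + 1" 1] rs unfolding inP_def by auto
  have top: "\<not> inP 0 (s + 1)" using attach[of 0 "s + 1"] attach[of 1 "s + 1"] rs unfolding inP_def by auto
  have above: "m = 0 \<or> (m = r \<and> yw = 1)" if "inP m 1" "0 \<le> m" "m \<le> r" for m
    using attach[of m 1] attach[of "m + 1" 1] rs that unfolding inP_def by auto
  have below: "m = r \<and> yw = 0" if "inP m (- 1)" "0 \<le> m" "m \<le> r" for m
    using attach[of m 0] attach[of "m + 1" 0] rs that unfolding inP_def by auto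
  have i: "0 \<le> i" using left box[of "- 1" 0] a by force
  have k: "k \<le> r + 1" using right box[of "r + 1" 0] a by force
  show ?thesis
  proof (cases "j < 0")
    case True
    have *: "m = r \<and> yw = 0" if "i \<le> m" "m < k" for m
      using below[of m] box[of m "- 1"] True a i k that by auto
    have "i = r" "k = r + 1" "yw = 0" using *[of i] *[of "k - 1"] a by auto
    moreover have "l = 1"
      using above[of r] box[of r 1] calculation a True rs by force
    ultimately show ?thesis using True by auto
  next
    case False
    then have j: "j = 0" using a by auto
    show ?thesis
    proof (cases "l = 1")
      case True
      then show ?thesis using j i k by auto
    next
      case l: False
      have *: "m = 0 \<or> (m = r \<and> yw = 1)" if "i \<le> m" "m < k" for m
        using above[of m] box[of m 1] l j a i k that by auto
      show ?thesis
      proof (cases "i = 0")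
        case True
        have "k = 1" using *[of 1] True a rs by force
        moreover have "l \<le> s + 1" using top box[of 0 "s + 1"] a True j rs by force
        ultimately show ?thesis using True j by auto
      next
        case False
        then show ?thesis using *[of i] *[of "k - 1"] a i j l by auto
      qed
    qed
  qed
qed

text \<open>All four kinds of contact between \<open>\<L>\<close> and \<open>\<C>\<close> at once: \<open>yw\<close> and \<open>xw\<close> are the row and the column,
  relative to \<open>p\<close>, that \<open>\<C>\<close> is attached to, and \<open>yu\<close> and \<open>xu\<close> the unattached ones.\<close>

locale LC_configuration =
  fixes p :: point and r s :: nat and C P :: cells and xu xw yu yw :: int
  assumes rs: "2 \<le> r" "2 \<le> s"
    and coord: "(xu = 0 \<and> xw = 1) \<or> (xu = 1 \<and> xw = 0)" "(yu = 0 \<and> yw = 1) \<or> (yu = 1 \<and> yw = 0)"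
    and finP: "finite P" and C_cells: "C \<subseteq> range cell"
    and P: "P = cells_L p r s \<union> C" and disj: "cells_L p r s \<inter> C = {}"
    and attach: "vertices (cells_L p r s) \<inter> vertices C =
      {p + (xw, int s), p + (xw, int s + 1), p + (int r, yw), p + (int r + 1, yw)}"
begin

abbreviation pt :: "int \<Rightarrow> int \<Rightarrow> point" where "pt x y \<equiv> p + (x, y)"

text \<open>From here on, points and cells are addressed by coordinates relative to \<open>p\<close>, and a cell by its lower
  left corner; \<open>onC\<close> describes the vertices of \<open>\<C>\<close>.\<close>

definition inC :: "int \<Rightarrow> int \<Rightarrow> bool" where "inC m n \<longleftrightarrow> cell (pt m n) \<in> C"

definition onC :: "int \<Rightarrow> int \<Rightarrow> bool" where
  "onC x y \<longleftrightarrow> inC x y \<or> inC (x - 1) y \<or> inC x (y - 1) \<or> inC (x - 1) (y - 1)"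

lemma row_cells_iff: "cell (pt m n) \<in> row_cells p r \<longleftrightarrow> n = 0 \<and> 0 \<le> m \<and> m \<le> int r"
proof -
  have "cell (pt m n) \<in> row_cells p r \<longleftrightarrow> (\<exists>k\<in>{0..r}. m = int k \<and> n = 0)"
    by (auto simp: row_cells_def cellA_def cell_eq_iff)
  also have "\<dots> \<longleftrightarrow> n = 0 \<and> 0 \<le> m \<and> m \<le> int r"
  proof
    assume "n = 0 \<and> 0 \<le> m \<and> m \<le> int r"
    then show "\<exists>k\<in>{0..r}. m = int k \<and> n = 0" by (intro bexI[of _ "nat m"]) auto
  qed auto
  finally show ?thesis .
qed

lemma column_cells_iff: "cell (pt m n) \<in> column_cells p s \<longleftrightarrow> m = 0 \<and> 0 \<le> n \<and> n \<le> int s"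
proof -
  have "cell (pt m n) \<in> column_cells p s \<longleftrightarrow> (\<exists>k\<in>{0..s}. m = 0 \<and> n = int k)"
    by (auto simp: column_cells_def cellB_def cell_eq_iff)
  also have "\<dots> \<longleftrightarrow> m = 0 \<and> 0 \<le> n \<and> n \<le> int s"
  proof
    assume "m = 0 \<and> 0 \<le> n \<and> n \<le> int s"
    then show "\<exists>k\<in>{0..s}. m = 0 \<and> n = int k" by (intro bexI[of _ "nat n"]) auto
  qed auto
  finally show ?thesis .
qed

lemma cells_L_iff: "cell (pt m n) \<in> cells_L p r s \<longleftrightarrow>
  (n = 0 \<and> 0 \<le> m \<and> m \<le> int r) \<or> (m = 0 \<and> 0 \<le> n \<and> n \<le> int s)"
  by (simp add: cells_L_def row_cells_iff column_cells_iff)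

lemma cells_L_range: "cells_L p r s \<subseteq> range cell"
  by (auto simp: cells_L_def row_cells_def column_cells_def cellA_def cellB_def)

lemma P_range: "P \<subseteq> range cell"
  using P cells_L_range C_cells by blast

lemma P_iff: "cell (pt m n) \<in> P \<longleftrightarrow>
  (n = 0 \<and> 0 \<le> m \<and> m \<le> int r) \<or> (m = 0 \<and> 0 \<le> n \<and> n \<le> int s) \<or> inC m n"
  by (auto simp: P cells_L_iff inC_def)

lemma inC_not_L: "inC m n \<Longrightarrow> \<not> (n = 0 \<and> 0 \<le> m \<and> m \<le> int r) \<and> \<not> (m = 0 \<and> 0 \<le> n \<and> n \<le> int s)"
  using disj cells_L_iff[of m n] unfolding inC_def by blast

lemma onC_iff: "pt x y \<in> vertices C \<longleftrightarrow> onC x y"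
  using vertices_iff[OF C_cells] unfolding onC_def inC_def .

lemma vertices_L_iff: "pt x y \<in> vertices (cells_L p r s) \<longleftrightarrow>
  (0 \<le> x \<and> x \<le> int r + 1 \<and> 0 \<le> y \<and> y \<le> 1) \<or> (0 \<le> x \<and> x \<le> 1 \<and> 0 \<le> y \<and> y \<le> int s + 1)"
proof -
  have "0 \<le> z \<and> z \<le> 1 \<longleftrightarrow> z = 0 \<or> z = 1" for z :: int by linarith
  then have eq: "((0 \<le> x \<and> x \<le> int r + 1 \<and> 0 \<le> y \<and> y \<le> 1) \<or> (0 \<le> x \<and> x \<le> 1 \<and> 0 \<le> y \<and> y \<le> int s + 1)) \<longleftrightarrow>
    ((y = 0 \<or> y = 1) \<and> 0 \<le> x \<and> x \<le> int r + 1) \<or> ((x = 0 \<or> x = 1) \<and> 0 \<le> y \<and> y \<le> int s + 1)"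
    by blast
  show ?thesis
    unfolding eq vertices_iff[OF cells_L_range] cells_L_iff
      strip_vertices[of 0 "int r" y x, OF of_nat_0_le_iff, symmetric]
      strip_vertices[of 0 "int s" x y, OF of_nat_0_le_iff, symmetric] by (simp only: disj_ac)
qed

lemma vertices_P: "vertices P = vertices (cells_L p r s) \<union> vertices C"
  unfolding vertices_def P by blast

lemma finite_vertices: "S \<subseteq> P \<Longrightarrow> finite (vertices S)"
  unfolding vertices_def
proof (rule finite_Union)
  assume S: "S \<subseteq> P"
  then show "finite S" using finP finite_subset by blast
  show "finite c" if c: "c \<in> S" for c
  proof -
    obtain u where "c = cell u" using S P_range c by blast
    then show ?thesis using finite_cell by simp
  qed
qed

lemma attach_iff:
  assumes "(0 \<le> x \<and> x \<le> int r + 1 \<and> 0 \<le> y \<and> y \<le> 1) \<or> (0 \<le> x \<and> x \<le> 1 \<and> 0 \<le> y \<and> y \<le> int s + 1)"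
  shows "onC x y \<longleftrightarrow> (x = xw \<and> (y = int s \<or> y = int s + 1)) \<or> (y = yw \<and> (x = int r \<or> x = int r + 1))"
proof -
  have "onC x y \<longleftrightarrow> pt x y \<in> vertices (cells_L p r s) \<inter> vertices C"
    using assms vertices_L_iff[of x y] onC_iff[of x y] by blast
  then show ?thesis unfolding attach by auto
qed

text \<open>The vertical bar is treated by \<open>box_through_row\<close> with the coordinates exchanged.  In the cases
  \<open>row_end\<close> and \<open>column_end\<close>, one pair of adjacent corners lies on the unattached line: the interval
  leaves the bar through the attached one.\<close>

lemma inner_interval_P_cases:
  assumes "inner_interval P (pt i j) (pt k l)"
  obtains (row) "j = 0" "l = 1" "0 \<le> i" "k \<le> int r + 1"
  | (column) "i = 0" "k = 1" "0 \<le> j" "l \<le> int s + 1"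
  | (row_end) "i = int r" "k = int r + 1" "j \<le> 0" "1 \<le> l" "j = yu \<or> l = yu"
  | (column_end) "j = int s" "l = int s + 1" "i \<le> 0" "1 \<le> k" "i = xu \<or> k = xu"
  | (C) "inner_interval C (pt i j) (pt k l)" "onC i j" "onC i l" "onC k j" "onC k l"
proof -
  have lt: "i < k" "j < l" using assms unfolding inner_interval_iff by auto
  have box: "cell (pt m n) \<in> P" if "i \<le> m" "m < k" "j \<le> n" "n < l" for m n
    using assms that unfolding inner_interval_iff by auto
  note box' = box[unfolded P_iff]
  have att: "(x = xw \<and> (y = int s \<or> y = int s + 1)) \<or> (y = yw \<and> (x = int r \<or> x = int r + 1))"
    if "(0 \<le> x \<and> x \<le> int r + 1 \<and> 0 \<le> y \<and> y \<le> 1) \<or> (0 \<le> x \<and> x \<le> 1 \<and> 0 \<le> y \<and> y \<le> int s + 1)"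
      "inC x y \<or> inC (x - 1) y \<or> inC x (y - 1) \<or> inC (x - 1) (y - 1)" for x y
    using attach_iff that unfolding onC_def by blast
  consider (A) a where "i \<le> a" "a < k" "j \<le> 0" "0 < l" "0 \<le> a" "a \<le> int r"
    | (B) b where "i \<le> 0" "0 < k" "j \<le> b" "b < l" "0 \<le> b" "b \<le> int s"
    | (N) "\<And>m n. i \<le> m \<Longrightarrow> m < k \<Longrightarrow> j \<le> n \<Longrightarrow> n < l \<Longrightarrow> inC m n"
    using box' by metis
  then show ?thesis
  proof cases
    case A
    have "(j = 0 \<and> l = 1 \<and> 0 \<le> i \<and> k \<le> int r + 1) \<or> (i = 0 \<and> k = 1 \<and> 0 \<le> j \<and> l \<le> int s + 1) \<or>
      (i = int r \<and> k = int r + 1 \<and> (j = 0 \<and> 2 \<le> l \<and> yw = 1 \<or> j < 0 \<and> l = 1 \<and> yw = 0))"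
      by (rule box_through_row[of "int r" "int s" inC xw yw i k j l a]) (use rs att box' A in auto)
    then show ?thesis using row column row_end coord by auto
  next
    case B
    have "(i = 0 \<and> k = 1 \<and> 0 \<le> j \<and> l \<le> int s + 1) \<or> (j = 0 \<and> l = 1 \<and> 0 \<le> i \<and> k \<le> int r + 1) \<or>
      (j = int s \<and> l = int s + 1 \<and> (i = 0 \<and> 2 \<le> k \<and> xw = 1 \<or> i < 0 \<and> k = 1 \<and> xw = 0))"
    proof (rule box_through_row[of "int s" "int r" "\<lambda>m n. inC n m" yw xw j l i k b])
      fix x y assume "0 \<le> x \<and> x \<le> int s + 1 \<and> 0 \<le> y \<and> y \<le> 1 \<or> 0 \<le> x \<and> x \<le> 1 \<and> 0 \<le> y \<and> y \<le> int r + 1"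
        "inC y x \<or> inC y (x - 1) \<or> inC (y - 1) x \<or> inC (y - 1) (x - 1)"
      then show "x = yw \<and> (y = int r \<or> y = int r + 1) \<or> y = xw \<and> (x = int s \<or> x = int s + 1)"
        using att[of y x] by blast
    qed (use rs box' B in auto)
    then show ?thesis using row column column_end coord by auto
  next
    case N
    have "inner_interval C (pt i j) (pt k l)"
      unfolding inner_interval_iff using lt N unfolding inC_def by blast
    moreover have "onC i j" "onC i l" "onC k j" "onC k l"
      using N[of i j] N[of i "l - 1"] N[of "k - 1" j] N[of "k - 1" "l - 1"] lt unfolding onC_def by auto
    ultimately show ?thesis by (rule C)
  qed
qed

end

section \<open>The four quotients\<close>

lemma inner_interval_mono: "inner_interval S u v \<Longrightarrow> S \<subseteq> S' \<Longrightarrow> inner_interval S' u v"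
  unfolding inner_interval_def by blast

lemma subst_minor:
  "subst h (minor p i k j l) = h (p + (i, j)) * h (p + (k, l)) - h (p + (i, l)) * h (p + (k, j))"
  by (simp add: minor_def subst_diff subst_mult)

definition region :: "point \<Rightarrow> (int \<Rightarrow> int \<Rightarrow> bool) \<Rightarrow> point set" where
  "region p Q = {p + (x, y) |x y. Q x y}"

lemma mem_region [simp]: "p + (x, y) \<in> region p Q \<longleftrightarrow> Q x y"
  by (cases p) (auto simp: region_def)

definition relocate :: "point \<Rightarrow> (int \<Rightarrow> int \<Rightarrow> int \<times> int) \<Rightarrow> point \<Rightarrow> point" where
  "relocate p f v = p + f (fst v - fst p) (snd v - snd p)"

lemma relocate_simp [simp]: "relocate p f (p + (x, y)) = p + f x y"
  by (cases p) (simp add: relocate_def)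

context LC_configuration
begin

definition onL :: "int \<Rightarrow> int \<Rightarrow> bool" where
  "onL x y \<longleftrightarrow> (0 \<le> x \<and> x \<le> int r + 1 \<and> 0 \<le> y \<and> y \<le> 1) \<or> (0 \<le> x \<and> x \<le> 1 \<and> 0 \<le> y \<and> y \<le> int s + 1)"

abbreviation "V \<equiv> vertices P"
abbreviation "P1 \<equiv> P - row_cells p r"
abbreviation "P2 \<equiv> P - column_cells p s"
abbreviation "P3 \<equiv> P - (row_cells p r \<union> column_cells p s)"
abbreviation "P4 \<equiv> P - {cellA p 0, cellA p 1, cellB p 1}"

lemma mem_V: "pt x y \<in> V \<longleftrightarrow> onL x y \<or> onC x y"
  unfolding vertices_P by (simp add: vertices_L_iff onC_iff onL_def)

lemma onC_onL: "onC x y \<Longrightarrow> onL x y \<Longrightarrow>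
    (x = xw \<and> (y = int s \<or> y = int s + 1)) \<or> (y = yw \<and> (x = int r \<or> x = int r + 1))"
  using attach_iff[of x y] unfolding onL_def by blast

lemma onC_attached: "onC (int r) yw" "onC (int r + 1) yw" "onC xw (int s)" "onC xw (int s + 1)"
  using attach_iff coord rs by auto

lemma P3_eq: "P3 = C"
  using P disj by (auto simp: cells_L_def)

lemma C_subset: "C \<subseteq> P1" "C \<subseteq> P2" "C \<subseteq> P4"
proof -
  have "cellA p 0 \<in> cells_L p r s" "cellA p 1 \<in> cells_L p r s" "cellB p 1 \<in> cells_L p r s"
    using rs by (auto simp: cells_L_def row_cells_def column_cells_def)
  then show "C \<subseteq> P1" "C \<subseteq> P2" "C \<subseteq> P4"
    using P disj by (auto simp: cells_L_def)
qed

lemma P1_iff: "cell (pt m n) \<in> P1 \<longleftrightarrow> (m = 0 \<and> 1 \<le> n \<and> n \<le> int s) \<or> inC m n"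
  using P_iff[of m n] row_cells_iff[of m n] inC_not_L[of m n] by auto

lemma P2_iff: "cell (pt m n) \<in> P2 \<longleftrightarrow> (n = 0 \<and> 1 \<le> m \<and> m \<le> int r) \<or> inC m n"
  using P_iff[of m n] column_cells_iff[of m n] inC_not_L[of m n] by auto

lemma P4_iff: "cell (pt m n) \<in> P4 \<longleftrightarrow>
  (n = 0 \<and> 2 \<le> m \<and> m \<le> int r) \<or> (m = 0 \<and> 2 \<le> n \<and> n \<le> int s) \<or> inC m n"
proof -
  have "cell (pt m n) \<in> {cellA p 0, cellA p 1, cellB p 1} \<longleftrightarrow>
    (m = 0 \<and> n = 0) \<or> (m = 1 \<and> n = 0) \<or> (m = 0 \<and> n = 1)"
    by (auto simp: cellA_def cellB_def cell_eq_iff)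
  then have P4: "cell (pt m n) \<in> P4 \<longleftrightarrow> cell (pt m n) \<in> P \<and>
    \<not> ((m = 0 \<and> n = 0) \<or> (m = 1 \<and> n = 0) \<or> (m = 0 \<and> n = 1))" by blast
  show ?thesis
  proof (cases "inC m n")
    case True
    then show ?thesis using inC_not_L[OF True] rs unfolding P4 P_iff by auto
  next
    case False
    have "((n = 0 \<and> 0 \<le> m \<and> m \<le> a) \<or> (m = 0 \<and> 0 \<le> n \<and> n \<le> b)) \<and>
      \<not> ((m = 0 \<and> n = 0) \<or> (m = 1 \<and> n = 0) \<or> (m = 0 \<and> n = 1)) \<longleftrightarrow>
      (n = 0 \<and> 2 \<le> m \<and> m \<le> a) \<or> (m = 0 \<and> 2 \<le> n \<and> n \<le> b)" for a b :: int
      by presburger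
    from this[of "int r" "int s"] show ?thesis unfolding P4 P_iff using False by simp
  qed
qed

lemma mem_vertices_P1: "pt x y \<in> vertices P1 \<longleftrightarrow> ((x = 0 \<or> x = 1) \<and> 1 \<le> y \<and> y \<le> int s + 1) \<or> onC x y"
proof -
  have *: "P1 \<subseteq> range cell" "1 \<le> int s" using P_range rs by auto
  show ?thesis
    unfolding vertices_iff[OF *(1), of p x y, unfolded P1_iff] onC_def strip_vertices[OF *(2), symmetric]
    by (simp only: disj_ac)
qed

lemma mem_vertices_P2: "pt x y \<in> vertices P2 \<longleftrightarrow> ((y = 0 \<or> y = 1) \<and> 1 \<le> x \<and> x \<le> int r + 1) \<or> onC x y"
proof -
  have *: "P2 \<subseteq> range cell" "1 \<le> int r" using P_range rs by auto
  show ?thesis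
    unfolding vertices_iff[OF *(1), of p x y, unfolded P2_iff] onC_def strip_vertices[OF *(2), symmetric]
    by (simp only: disj_ac)
qed

lemma mem_vertices_P4: "pt x y \<in> vertices P4 \<longleftrightarrow> ((y = 0 \<or> y = 1) \<and> 2 \<le> x \<and> x \<le> int r + 1)
   \<or> ((x = 0 \<or> x = 1) \<and> 2 \<le> y \<and> y \<le> int s + 1) \<or> onC x y"
proof -
  have *: "P4 \<subseteq> range cell" "2 \<le> int r" "2 \<le> int s" using P_range rs by auto
  show ?thesis
    unfolding vertices_iff[OF *(1), of p x y, unfolded P4_iff] onC_def
      strip_vertices[OF *(2), symmetric] strip_vertices[OF *(3), symmetric]
    by (simp only: disj_ac)
qed

lemma column_minor:
  assumes "\<And>n. lo \<le> n \<Longrightarrow> n < hi \<Longrightarrow> cell (pt 0 n) \<in> S"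
    and "i = 0 \<or> i = 1" "k = 0 \<or> k = 1" "lo \<le> j" "j \<le> hi" "lo \<le> l" "l \<le> hi"
  shows "minor p i k j l \<in> ideal_gen W (inner_minors S)"
proof (rule minor_ideal_gen)
  assume "i \<noteq> k" "j \<noteq> l"
  then have ik: "min i k = 0" "max i k = 1" using assms by auto
  have "cell (pt m n) \<in> S" if "0 \<le> m" "m < 1" "min j l \<le> n" "n < max j l" for m n
  proof -
    have "m = 0" "lo \<le> n" "n < hi" using that assms(4-7) by linarith+
    then show ?thesis using assms(1) by simp
  qed
  then show "inner_interval S (pt (min i k) (min j l)) (pt (max i k) (max j l))"
    unfolding inner_interval_iff ik using \<open>j \<noteq> l\<close> by auto
qed

lemma row_minor:
  assumes "\<And>m. lo \<le> m \<Longrightarrow> m < hi \<Longrightarrow> cell (pt m 0) \<in> S"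
    and "j = 0 \<or> j = 1" "l = 0 \<or> l = 1" "lo \<le> i" "i \<le> hi" "lo \<le> k" "k \<le> hi"
  shows "minor p i k j l \<in> ideal_gen W (inner_minors S)"
proof (rule minor_ideal_gen)
  assume "i \<noteq> k" "j \<noteq> l"
  then have jl: "min j l = 0" "max j l = 1" using assms by auto
  have "cell (pt m n) \<in> S" if "0 \<le> n" "n < 1" "min i k \<le> m" "m < max i k" for m n
  proof -
    have "n = 0" "lo \<le> m" "m < hi" using that assms(4-7) by linarith+
    then show ?thesis using assms(1) by simp
  qed
  then show "inner_interval S (pt (min i k) (min j l)) (pt (max i k) (max j l))"
    unfolding inner_interval_iff jl using \<open>i \<noteq> k\<close> by auto
qed

lemma inner_minor: "inner_interval S (pt i j) (pt k l) \<Longrightarrow> minor p i k j l \<in> ideal_gen W (inner_minors S)"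
  unfolding inner_minors_eq[of S p] by (rule ideal_gen_base) blast

lemma inner_minorsE:
  assumes "g \<in> inner_minors S"
  obtains i k j l where "g = minor p i k j l" "inner_interval S (pt i j) (pt k l)"
  using assms unfolding inner_minors_eq[of S p] by blast

lemma far_column: "int s \<noteq> 1" "int s \<noteq> 0" "s \<noteq> 0" "int s \<noteq> yu" "int s + 1 \<noteq> yu" "int s \<noteq> yw" "int s + 1 \<noteq> yw"
  using coord(2) rs by auto

lemma far_row: "int r \<noteq> 1" "int r \<noteq> 0" "r \<noteq> 0" "int r \<noteq> xu" "int r + 1 \<noteq> xu" "int r \<noteq> xw" "int r + 1 \<noteq> xw"
  using coord(1) rs by auto

lemma V_cases_row:
  assumes "pt x y \<in> V"
  obtains "y = yu" "0 \<le> x" "x \<le> int r + 1" | "y = yw" "x = 0 \<or> x = 1" | "y = yw" "2 \<le> x" "x \<le> int r - 1"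
  | "x = 0 \<or> x = 1" "2 \<le> y" "y \<le> int s + 1" | "onC x y"
proof -
  have "onL x y \<Longrightarrow> (y = yu \<or> y = yw) \<and> 0 \<le> x \<and> x \<le> int r + 1 \<or> (x = 0 \<or> x = 1) \<and> 2 \<le> y \<and> y \<le> int s + 1"
    using coord(2) rs unfolding onL_def by linarith
  moreover have "0 \<le> x \<Longrightarrow> x \<le> int r + 1 \<Longrightarrow> x = 0 \<or> x = 1 \<or> 2 \<le> x \<and> x \<le> int r - 1 \<or> x = int r \<or> x = int r + 1"
    by linarith
  ultimately show ?thesis using assms that onC_attached unfolding mem_V by metis
qed

text \<open>The reason why the retraction onto the ring of \<open>\<P>\<^sub>1\<close> leaves the variables of \<open>\<C>\<close> alone: the vertices of \<open>\<C>\<close> in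
  the horizontal bar lie on the attached row, at abscissae \<open>r\<close> and \<open>r + 1\<close>.\<close>

lemma C_fixed_row:
  assumes "onC x y"
  shows "\<not> (y = yu \<and> 0 \<le> x \<and> x \<le> int r + 1)" "\<not> ((x = 0 \<or> x = 1) \<and> (y = yw \<or> y = 1))"
proof -
  have "onL x y \<Longrightarrow> 2 \<le> x \<or> 2 \<le> y" "onL x y \<Longrightarrow> y = yu \<Longrightarrow> 0 \<le> x \<Longrightarrow> False"
    using onC_onL[OF assms] coord rs by linarith+
  moreover have "y = yu \<and> 0 \<le> x \<and> x \<le> int r + 1 \<Longrightarrow> onL x y"
    "(x = 0 \<or> x = 1) \<and> (y = yw \<or> y = 1) \<Longrightarrow> onL x y"
    using coord rs unfolding onL_def by linarith+
  ultimately show "\<not> (y = yu \<and> 0 \<le> x \<and> x \<le> int r + 1)" "\<not> ((x = 0 \<or> x = 1) \<and> (y = yw \<or> y = 1))"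
    using coord by auto
qed

subsection \<open>Killing the unattached row\<close>

text \<open>The collection \<open>\<P>\<^sub>1\<close> keeps the vertices of the bar \<open>[B\<^sub>1, B\<^sub>s]\<close>, whose lowest row is at height 1.  If
  the unattached row is the upper one, that row is killed, and the two corners at height \<open>yw = 0\<close> must
  take its place: \<open>\<sigma>_row\<close> moves them up.  If the unattached row is the lower one, \<open>\<sigma>_row\<close> is the identity.
  The points of \<open>free_row\<close> are those vertices of the attached row that are neither corners of \<open>A\<close>
  nor vertices of \<open>\<C>\<close>.\<close>

abbreviation "unattached_row \<equiv> region p (\<lambda>x y. y = yu \<and> 0 \<le> x \<and> x \<le> int r + 1)"
abbreviation "free_row \<equiv> region p (\<lambda>x y. y = yw \<and> 2 \<le> x \<and> x \<le> int r - 1)"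
abbreviation "\<sigma>_row \<equiv> relocate p (\<lambda>x y. if (x = 0 \<or> x = 1) \<and> y = yw then (x, 1) else (x, y))"
abbreviation "\<tau>_row \<equiv> relocate p (\<lambda>x y. if (x = 0 \<or> x = 1) \<and> y = 1 then (x, yw) else (x, y))"

lemma kill_C_row: "onC x y \<Longrightarrow> (if pt x y \<in> unattached_row then 0 else var (\<sigma>_row (pt x y))) = var (pt x y)"
  using C_fixed_row[of x y] unfolding mem_region relocate_simp by auto

lemma move_C_row: "onC x y \<Longrightarrow> \<tau>_row (pt x y) = pt x y"
  using C_fixed_row[of x y] unfolding relocate_simp by auto

text \<open>A minor of the horizontal bar, or of an interval through \<open>A\<^sub>r\<close> into \<open>\<C>\<close>, has a killed variable in
  both terms.  A minor of the vertical bar becomes zero if it uses the unattached row, and otherwise becomes a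
  minor of \<open>[B\<^sub>1, B\<^sub>s]\<close>.  The remaining minors are not changed.\<close>

lemma retraction_P1:
  "variable_retraction V (vertices P1 \<union> free_row) unattached_row \<sigma>_row \<tau>_row (inner_minors P :: 'k::field mpoly set) (inner_minors P1)"
proof unfold_locales
  show "finite V" using finite_vertices by blast
  show "unattached_row \<subseteq> V"
  proof
    fix v assume "v \<in> unattached_row"
    moreover obtain x y where "v = pt x y" by (rule point_cases)
    ultimately show "v \<in> V" using coord by (auto simp: mem_V onL_def)
  qed
  show "\<sigma>_row v \<in> vertices P1 \<union> free_row \<and> \<tau>_row (\<sigma>_row v) = v" if "v \<in> V" "v \<notin> unattached_row" for v
  proof -
    obtain x y where v: "v = pt x y" by (rule point_cases)
    from that(1)[unfolded v] show ?thesis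
    proof (cases rule: V_cases_row)
      case 1
      then show ?thesis using that(2) v by simp
    next
      case 4
      then show ?thesis using coord(2) by (auto simp: v mem_vertices_P1)
    next
      case 5
      then show ?thesis using C_fixed_row[OF 5] by (auto simp: v mem_vertices_P1)
    qed (use rs in \<open>auto simp: v mem_vertices_P1\<close>)
  qed
  show "\<tau>_row v \<in> V \<and> \<tau>_row v \<notin> unattached_row \<and> \<sigma>_row (\<tau>_row v) = v" if "v \<in> vertices P1 \<union> free_row" for v
  proof -
    obtain x y where v: "v = pt x y" by (rule point_cases)
    have yw: "yw \<noteq> yu" "0 \<le> yw" "yw \<le> 1" "yu \<le> 1" using coord by auto
    from that consider "x = 0 \<or> x = 1" "y = 1" | "x = 0 \<or> x = 1" "2 \<le> y" "y \<le> int s + 1"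
      | "onC x y" | "y = yw" "2 \<le> x" "x \<le> int r - 1"
      unfolding v Un_iff mem_vertices_P1 mem_region by force
    then show ?thesis
    proof cases
      case 1
      then show ?thesis using yw by (auto simp: v mem_V onL_def)
    next
      case 2
      then show ?thesis using yw by (auto simp: v mem_V onL_def)
    next
      case 3
      then show ?thesis using C_fixed_row[OF 3] by (auto simp: v mem_V)
    next
      case 4
      then show ?thesis using yw by (auto simp: v mem_V onL_def)
    qed
  qed
  show "inner_minors P \<subseteq> polys V" by (rule inner_minors_polys)
  show "subst (\<lambda>v. if v \<in> unattached_row then 0 else var (\<sigma>_row v)) g \<in> ideal_gen (vertices P1 \<union> free_row) (inner_minors P1)"
    if g: "g \<in> (inner_minors P :: 'k mpoly set)" for g
  proof -
    obtain i k j l where g: "g = minor p i k j l" and box: "inner_interval P (pt i j) (pt k l)"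
      using g by (rule inner_minorsE)
    from box show ?thesis
    proof (cases rule: inner_interval_P_cases)
      case row
      have "i < k" using box unfolding inner_interval_iff by blast
      then show ?thesis using row coord by (auto simp: g subst_minor ideal_gen.zero)
    next
      case column
      show ?thesis
      proof (cases "j = yu \<or> l = yu")
        case True
        then show ?thesis using column by (auto simp: g subst_minor ideal_gen.zero)
      next
        case False
        let ?f = "\<lambda>y. if y = yw then 1 else y"
        have "j < l" using box unfolding inner_interval_iff by blast
        then have "minor p 0 1 (?f j) (?f l) \<in> ideal_gen (vertices P1 \<union> free_row) (inner_minors P1 :: 'k mpoly set)"
          using False column coord rs by (intro column_minor[of 1 "int s + 1"]) (auto simp: P_iff row_cells_iff)
        then show ?thesis using False column unfolding g subst_minor by (auto simp: minor_def)
      qed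
    next
      case row_end
      then show ?thesis by (auto simp: g subst_minor ideal_gen.zero)
    next
      case column_end
      have "inner_interval P1 (pt i j) (pt k l)"
        using box column_end rs unfolding inner_interval_iff by (auto simp: row_cells_iff)
      from inner_minor[OF this] show ?thesis
        using column_end(1,2) far_column unfolding g subst_minor by (simp add: minor_def)
    next
      case C
      from inner_minor[OF inner_interval_mono[OF C(1) C_subset(1)]] show ?thesis
        unfolding g subst_minor C(2-5)[THEN kill_C_row] unfolding minor_def .
    qed
  qed
  show "subst (\<lambda>v. var (\<tau>_row v)) g \<in> ideal_gen V (inner_minors P)"
    if g: "g \<in> (inner_minors P1 :: 'k mpoly set)" for g
  proof -
    obtain i k j l where g: "g = minor p i k j l" and box: "inner_interval P1 (pt i j) (pt k l)"
      using g by (rule inner_minorsE)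
    have boxP: "inner_interval P (pt i j) (pt k l)" by (rule inner_interval_mono[OF box]) blast
    have lt: "i < k" "j < l" using box unfolding inner_interval_iff by blast+
    have no_row: False if "i \<le> m" "m < k" "j \<le> 0" "0 < l" "0 \<le> m" "m \<le> int r" for m
      using box that row_cells_iff[of m 0] unfolding inner_interval_iff by auto
    from boxP show ?thesis
    proof (cases rule: inner_interval_P_cases)
      case row
      then show ?thesis using no_row[of i] lt rs by auto
    next
      case column
      let ?f = "\<lambda>y. if y = 1 then yw else y"
      have "minor p 0 1 (?f j) (?f l) \<in> ideal_gen V (inner_minors P :: 'k mpoly set)"
        using column coord rs lt by (intro column_minor[of 0 "int s + 1"]) (auto simp: P_iff)
      then show ?thesis using column unfolding g subst_minor by (auto simp: minor_def)
    next
      case row_end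
      then show ?thesis using no_row[of i] lt rs by auto
    next
      case column_end
      from inner_minor[OF boxP] show ?thesis
        using column_end(1,2) far_column unfolding g subst_minor by (simp add: minor_def)
    next
      case C
      from inner_minor[OF boxP] show ?thesis
        unfolding g subst_minor C(2-5)[THEN move_C_row] unfolding minor_def .
    qed
  qed
qed


subsection \<open>Killing the unattached column\<close>

lemma V_cases_column:
  assumes "pt x y \<in> V"
  obtains "x = xu" "0 \<le> y" "y \<le> int s + 1" | "x = xw" "y = 0 \<or> y = 1" | "x = xw" "2 \<le> y" "y \<le> int s - 1"
  | "y = 0 \<or> y = 1" "2 \<le> x" "x \<le> int r + 1" | "onC x y"
proof -
  have "onL x y \<Longrightarrow> (x = xu \<or> x = xw) \<and> 0 \<le> y \<and> y \<le> int s + 1 \<or> (y = 0 \<or> y = 1) \<and> 2 \<le> x \<and> x \<le> int r + 1"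
    using coord(1) rs unfolding onL_def by linarith
  moreover have "0 \<le> y \<Longrightarrow> y \<le> int s + 1 \<Longrightarrow> y = 0 \<or> y = 1 \<or> 2 \<le> y \<and> y \<le> int s - 1 \<or> y = int s \<or> y = int s + 1"
    by linarith
  ultimately show ?thesis using assms that onC_attached unfolding mem_V by metis
qed

lemma C_fixed_column:
  assumes "onC x y"
  shows "\<not> (x = xu \<and> 0 \<le> y \<and> y \<le> int s + 1)" "\<not> ((y = 0 \<or> y = 1) \<and> (x = xw \<or> x = 1))"
proof -
  have "onL x y \<Longrightarrow> 2 \<le> x \<or> 2 \<le> y" "onL x y \<Longrightarrow> x = xu \<Longrightarrow> 0 \<le> y \<Longrightarrow> False"
    using onC_onL[OF assms] coord rs by linarith+
  moreover have "x = xu \<and> 0 \<le> y \<and> y \<le> int s + 1 \<Longrightarrow> onL x y"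
    "(y = 0 \<or> y = 1) \<and> (x = xw \<or> x = 1) \<Longrightarrow> onL x y"
    using coord rs unfolding onL_def by linarith+
  ultimately show "\<not> (x = xu \<and> 0 \<le> y \<and> y \<le> int s + 1)" "\<not> ((y = 0 \<or> y = 1) \<and> (x = xw \<or> x = 1))"
    using coord by auto
qed

text \<open>The transposed situation, with the bar \<open>[A\<^sub>1, A\<^sub>r]\<close> whose leftmost column is at abscissa 1.\<close>

abbreviation "unattached_column \<equiv> region p (\<lambda>x y. x = xu \<and> 0 \<le> y \<and> y \<le> int s + 1)"
abbreviation "free_column \<equiv> region p (\<lambda>x y. x = xw \<and> 2 \<le> y \<and> y \<le> int s - 1)"
abbreviation "\<sigma>_column \<equiv> relocate p (\<lambda>x y. if (y = 0 \<or> y = 1) \<and> x = xw then (1, y) else (x, y))"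
abbreviation "\<tau>_column \<equiv> relocate p (\<lambda>x y. if (y = 0 \<or> y = 1) \<and> x = 1 then (xw, y) else (x, y))"

lemma kill_C_column: "onC x y \<Longrightarrow> (if pt x y \<in> unattached_column then 0 else var (\<sigma>_column (pt x y))) = var (pt x y)"
  using C_fixed_column[of x y] unfolding mem_region relocate_simp by auto

lemma move_C_column: "onC x y \<Longrightarrow> \<tau>_column (pt x y) = pt x y"
  using C_fixed_column[of x y] unfolding relocate_simp by auto

lemma retraction_P2:
  "variable_retraction V (vertices P2 \<union> free_column) unattached_column \<sigma>_column \<tau>_column (inner_minors P :: 'k::field mpoly set) (inner_minors P2)"
proof unfold_locales
  show "finite V" using finite_vertices by blast
  show "unattached_column \<subseteq> V"
  proof
    fix v assume "v \<in> unattached_column"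
    moreover obtain x y where "v = pt x y" by (rule point_cases)
    ultimately show "v \<in> V" using coord by (auto simp: mem_V onL_def)
  qed
  show "\<sigma>_column v \<in> vertices P2 \<union> free_column \<and> \<tau>_column (\<sigma>_column v) = v" if "v \<in> V" "v \<notin> unattached_column" for v
  proof -
    obtain x y where v: "v = pt x y" by (rule point_cases)
    from that(1)[unfolded v] show ?thesis
    proof (cases rule: V_cases_column)
      case 1
      then show ?thesis using that(2) v by simp
    next
      case 4
      then show ?thesis using coord(1) by (auto simp: v mem_vertices_P2)
    next
      case 5
      then show ?thesis using C_fixed_column[OF 5] by (auto simp: v mem_vertices_P2)
    qed (use rs in \<open>auto simp: v mem_vertices_P2\<close>)
  qed
  show "\<tau>_column v \<in> V \<and> \<tau>_column v \<notin> unattached_column \<and> \<sigma>_column (\<tau>_column v) = v" if "v \<in> vertices P2 \<union> free_column" for v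
  proof -
    obtain x y where v: "v = pt x y" by (rule point_cases)
    have xw: "xw \<noteq> xu" "0 \<le> xw" "xw \<le> 1" "xu \<le> 1" using coord by auto
    from that consider "y = 0 \<or> y = 1" "x = 1" | "y = 0 \<or> y = 1" "2 \<le> x" "x \<le> int r + 1"
      | "onC x y" | "x = xw" "2 \<le> y" "y \<le> int s - 1"
      unfolding v Un_iff mem_vertices_P2 mem_region by force
    then show ?thesis
    proof cases
      case 1
      then show ?thesis using xw by (auto simp: v mem_V onL_def)
    next
      case 2
      then show ?thesis using xw by (auto simp: v mem_V onL_def)
    next
      case 3
      then show ?thesis using C_fixed_column[OF 3] by (auto simp: v mem_V)
    next
      case 4
      then show ?thesis using xw by (auto simp: v mem_V onL_def)
    qed
  qed
  show "inner_minors P \<subseteq> polys V" by (rule inner_minors_polys)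
  show "subst (\<lambda>v. if v \<in> unattached_column then 0 else var (\<sigma>_column v)) g \<in> ideal_gen (vertices P2 \<union> free_column) (inner_minors P2)"
    if g: "g \<in> (inner_minors P :: 'k mpoly set)" for g
  proof -
    obtain i k j l where g: "g = minor p i k j l" and box: "inner_interval P (pt i j) (pt k l)"
      using g by (rule inner_minorsE)
    from box show ?thesis
    proof (cases rule: inner_interval_P_cases)
      case column
      have "j < l" using box unfolding inner_interval_iff by blast
      then show ?thesis using column coord by (auto simp: g subst_minor ideal_gen.zero)
    next
      case row
      show ?thesis
      proof (cases "i = xu \<or> k = xu")
        case True
        then show ?thesis using row by (auto simp: g subst_minor ideal_gen.zero)
      next
        case False
        let ?f = "\<lambda>x. if x = xw then 1 else x"
        have "i < k" using box unfolding inner_interval_iff by blast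
        then have "minor p (?f i) (?f k) 0 1 \<in> ideal_gen (vertices P2 \<union> free_column) (inner_minors P2 :: 'k mpoly set)"
          using False row coord rs by (intro row_minor[of 1 "int r + 1"]) (auto simp: P_iff column_cells_iff)
        then show ?thesis using False row unfolding g subst_minor by (auto simp: minor_def)
      qed
    next
      case column_end
      then show ?thesis by (auto simp: g subst_minor ideal_gen.zero)
    next
      case row_end
      have "inner_interval P2 (pt i j) (pt k l)"
        using box row_end rs unfolding inner_interval_iff by (auto simp: column_cells_iff)
      from inner_minor[OF this] show ?thesis
        using row_end(1,2) far_row unfolding g subst_minor by (simp add: minor_def)
    next
      case C
      from inner_minor[OF inner_interval_mono[OF C(1) C_subset(2)]] show ?thesis
        unfolding g subst_minor C(2-5)[THEN kill_C_column] unfolding minor_def .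
    qed
  qed
  show "subst (\<lambda>v. var (\<tau>_column v)) g \<in> ideal_gen V (inner_minors P)"
    if g: "g \<in> (inner_minors P2 :: 'k mpoly set)" for g
  proof -
    obtain i k j l where g: "g = minor p i k j l" and box: "inner_interval P2 (pt i j) (pt k l)"
      using g by (rule inner_minorsE)
    have boxP: "inner_interval P (pt i j) (pt k l)" by (rule inner_interval_mono[OF box]) blast
    have lt: "i < k" "j < l" using box unfolding inner_interval_iff by blast+
    have no_column: False if "j \<le> n" "n < l" "i \<le> 0" "0 < k" "0 \<le> n" "n \<le> int s" for n
      using box that column_cells_iff[of 0 n] unfolding inner_interval_iff by auto
    from boxP show ?thesis
    proof (cases rule: inner_interval_P_cases)
      case column
      then show ?thesis using no_column[of j] lt rs by auto
    next
      case row
      let ?f = "\<lambda>x. if x = 1 then xw else x"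
      have "minor p (?f i) (?f k) 0 1 \<in> ideal_gen V (inner_minors P :: 'k mpoly set)"
        using row coord rs lt by (intro row_minor[of 0 "int r + 1"]) (auto simp: P_iff)
      then show ?thesis using row unfolding g subst_minor by (auto simp: minor_def)
    next
      case column_end
      then show ?thesis using no_column[of j] lt rs by auto
    next
      case row_end
      from inner_minor[OF boxP] show ?thesis
        using row_end(1,2) far_row unfolding g subst_minor by (simp add: minor_def)
    next
      case C
      from inner_minor[OF boxP] show ?thesis
        unfolding g subst_minor C(2-5)[THEN move_C_column] unfolding minor_def .
    qed
  qed
qed

subsection \<open>Killing both lines\<close>

abbreviation "free_points \<equiv> insert (pt xw yw) (free_row \<union> free_column)"

text \<open>With both unattached lines killed, every minor that involves a cell of \<open>\<L>\<close> vanishes; the surviving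
  corner of \<open>A\<close> and the interior points of the attached lines are free.\<close>

lemma retraction_P3:
  "variable_retraction V (vertices P3 \<union> free_points) (unattached_row \<union> unattached_column) id id (inner_minors P :: 'k::field mpoly set) (inner_minors P3)"
  unfolding P3_eq
proof unfold_locales
  show "finite V" using finite_vertices by blast
  interpret r1: variable_retraction V "vertices P1 \<union> free_row" unattached_row \<sigma>_row \<tau>_row "inner_minors P :: 'k::field mpoly set" "inner_minors P1"
    by (rule retraction_P1)
  interpret r2: variable_retraction V "vertices P2 \<union> free_column" unattached_column \<sigma>_column \<tau>_column "inner_minors P :: 'k::field mpoly set" "inner_minors P2"
    by (rule retraction_P2)
  show "unattached_row \<union> unattached_column \<subseteq> V" using r1.D r2.D by blast
  have w: "xw \<noteq> xu" "0 \<le> xw" "xw \<le> 1" "xu \<le> 1" "yw \<noteq> yu" "0 \<le> yw" "yw \<le> 1" "yu \<le> 1" using coord by auto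
  show "id v \<in> vertices C \<union> free_points \<and> id (id v) = v" if "v \<in> V" "v \<notin> unattached_row \<union> unattached_column" for v
  proof -
    obtain x y where v: "v = pt x y" by (rule point_cases)
    have D: "\<not> (y = yu \<and> 0 \<le> x \<and> x \<le> int r + 1)" "\<not> (x = xu \<and> 0 \<le> y \<and> y \<le> int s + 1)"
      using that(2) unfolding v by auto
    from that(1)[unfolded v] have "onC x y \<or> (x = xw \<and> y = yw) \<or> (y = yw \<and> 2 \<le> x \<and> x \<le> int r - 1)
      \<or> (x = xw \<and> 2 \<le> y \<and> y \<le> int s - 1)"
    proof (cases rule: V_cases_row)
      case 2
      then show ?thesis using D coord by auto
    next
      case 4
      then have x: "x = xw" using D coord by auto
      then have "2 \<le> y \<and> y \<le> int s - 1 \<or> y = int s \<or> y = int s + 1" using 4 by linarith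
      then show ?thesis using x onC_attached by auto
    qed (use D in auto)
    then show ?thesis unfolding v by (auto simp: onC_iff)
  qed
  show "id v \<in> V \<and> id v \<notin> unattached_row \<union> unattached_column \<and> id (id v) = v" if "v \<in> vertices C \<union> free_points" for v
  proof -
    obtain x y where v: "v = pt x y" by (rule point_cases)
    from that consider "onC x y" | "x = xw" "y = yw" | "y = yw" "2 \<le> x" "x \<le> int r - 1"
      | "x = xw" "2 \<le> y" "y \<le> int s - 1"
      unfolding v by (auto simp: onC_iff)
    then show ?thesis
    proof cases
      case 1
      then show ?thesis using C_fixed_row[OF 1] C_fixed_column[OF 1] by (auto simp: v mem_V)
    qed (use w in \<open>auto simp: v mem_V onL_def\<close>)
  qed
  show "inner_minors P \<subseteq> polys V" by (rule inner_minors_polys)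
  have kill: "(if pt x y \<in> unattached_row \<union> unattached_column then 0 else var (id (pt x y))) = (var (pt x y) :: 'k mpoly)" if "onC x y" for x y
    using C_fixed_row(1)[OF that] C_fixed_column(1)[OF that] unfolding Un_iff mem_region by auto
  show "subst (\<lambda>v. if v \<in> unattached_row \<union> unattached_column then 0 else var (id v)) g \<in> ideal_gen (vertices C \<union> free_points) (inner_minors C)"
    if g: "g \<in> (inner_minors P :: 'k mpoly set)" for g
  proof -
    obtain i k j l where g: "g = minor p i k j l" and box: "inner_interval P (pt i j) (pt k l)"
      using g by (rule inner_minorsE)
    have lt: "i < k" "j < l" using box unfolding inner_interval_iff by blast+
    from box show ?thesis
    proof (cases rule: inner_interval_P_cases)
      case row
      then show ?thesis using lt coord(2) by (auto simp: g subst_minor ideal_gen.zero)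
    next
      case column
      then show ?thesis using lt coord(1) by (auto simp: g subst_minor ideal_gen.zero)
    next
      case C
      from inner_minor[OF C(1)] show ?thesis
        unfolding g subst_minor C(2-5)[THEN kill] unfolding minor_def .
    qed (auto simp: g subst_minor ideal_gen.zero)
  qed
  show "subst (\<lambda>v. var (id v)) g \<in> ideal_gen V (inner_minors P)"
    if g: "g \<in> (inner_minors C :: 'k mpoly set)" for g
  proof -
    obtain i k j l where g: "g = minor p i k j l" and box: "inner_interval C (pt i j) (pt k l)"
      using g by (rule inner_minorsE)
    have "inner_interval P (pt i j) (pt k l)" using inner_interval_mono[OF box] P by blast
    from inner_minor[OF this] show ?thesis unfolding g subst_minor by (simp add: minor_def)
  qed
qed

subsection \<open>Killing the four corner variables\<close>

abbreviation "corner_points \<equiv> region p (\<lambda>x y. (x = 0 \<or> x = 1) \<and> (y = 0 \<or> y = 1))"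

text \<open>A minor of a bar involves a corner of \<open>A\<close> exactly if its interval contains one of the cells \<open>A\<close>, \<open>A\<^sub>1\<close>,
  \<open>B\<^sub>1\<close>, and then both of its terms do.\<close>

lemma retraction_P4:
  "variable_retraction V (vertices P4) corner_points id id (inner_minors P :: 'k::field mpoly set) (inner_minors P4)"
proof unfold_locales
  show "finite V" using finite_vertices by blast
  show "corner_points \<subseteq> V"
  proof
    fix v assume "v \<in> corner_points"
    moreover obtain x y where "v = pt x y" by (rule point_cases)
    ultimately show "v \<in> V" by (auto simp: mem_V onL_def)
  qed
  have C_corner: "\<not> ((x = 0 \<or> x = 1) \<and> (y = 0 \<or> y = 1))" if "onC x y" for x y
    using C_fixed_row[OF that] coord(2) by auto
  then have kill: "(if pt x y \<in> corner_points then 0 else var (id (pt x y))) = (var (pt x y) :: 'k mpoly)" if "onC x y" for x y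
    using that unfolding mem_region by auto
  show "id v \<in> vertices P4 \<and> id (id v) = v" if "v \<in> V" "v \<notin> corner_points" for v
  proof -
    obtain x y where v: "v = pt x y" by (rule point_cases)
    have "onL x y \<Longrightarrow> (y = 0 \<or> y = 1) \<and> 2 \<le> x \<and> x \<le> int r + 1 \<or> (x = 0 \<or> x = 1) \<and> 2 \<le> y \<and> y \<le> int s + 1
       \<or> (x = 0 \<or> x = 1) \<and> (y = 0 \<or> y = 1)"
      unfolding onL_def by linarith
    then show ?thesis using that unfolding v mem_V mem_vertices_P4 mem_region id_apply by blast
  qed
  show "id v \<in> V \<and> id v \<notin> corner_points \<and> id (id v) = v" if "v \<in> vertices P4" for v
  proof -
    obtain x y where v: "v = pt x y" by (rule point_cases)
    show ?thesis using that C_corner[of x y] unfolding v mem_vertices_P4 mem_V mem_region id_apply onL_def by auto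
  qed
  show "inner_minors P \<subseteq> polys V" by (rule inner_minors_polys)
  show "subst (\<lambda>v. if v \<in> corner_points then 0 else var (id v)) g \<in> ideal_gen (vertices P4) (inner_minors P4)"
    if g: "g \<in> (inner_minors P :: 'k mpoly set)" for g
  proof -
    obtain i k j l where g: "g = minor p i k j l" and box: "inner_interval P (pt i j) (pt k l)"
      using g by (rule inner_minorsE)
    have lt: "i < k" "j < l" using box unfolding inner_interval_iff by blast+
    from box show ?thesis
    proof (cases rule: inner_interval_P_cases)
      case row
      show ?thesis
      proof (cases "2 \<le> i")
        case True
        have "cell (pt m 0) \<in> P4" if "2 \<le> m" "m < int r + 1" for m
          using that unfolding P4_iff by auto
        then have "minor p i k 0 1 \<in> ideal_gen (vertices P4) (inner_minors P4 :: 'k mpoly set)"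
          using row True lt by (intro row_minor[of 2 "int r + 1"]) auto
        then show ?thesis using row True lt unfolding g subst_minor by (auto simp: minor_def)
      next
        case False
        then have "i = 0 \<or> i = 1" using row by linarith
        then show ?thesis using row by (auto simp: g subst_minor ideal_gen.zero)
      qed
    next
      case column
      show ?thesis
      proof (cases "2 \<le> j")
        case True
        have "cell (pt 0 n) \<in> P4" if "2 \<le> n" "n < int s + 1" for n
          using that unfolding P4_iff by auto
        then have "minor p 0 1 j l \<in> ideal_gen (vertices P4) (inner_minors P4 :: 'k mpoly set)"
          using column True lt by (intro column_minor[of 2 "int s + 1"]) auto
        then show ?thesis using column True lt unfolding g subst_minor by (auto simp: minor_def)
      next
        case False
        then have "j = 0 \<or> j = 1" using column by linarith
        then show ?thesis using column by (auto simp: g subst_minor ideal_gen.zero)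
      qed
    next
      case row_end
      have "inner_interval P4 (pt i j) (pt k l)"
        using box row_end rs unfolding inner_interval_iff P4_iff P_iff by auto
      from inner_minor[OF this] show ?thesis
        using row_end rs unfolding g subst_minor by (auto simp: minor_def)
    next
      case column_end
      have "inner_interval P4 (pt i j) (pt k l)"
        using box column_end rs unfolding inner_interval_iff P4_iff P_iff by auto
      from inner_minor[OF this] show ?thesis
        using column_end rs unfolding g subst_minor by (auto simp: minor_def)
    next
      case C
      from inner_minor[OF inner_interval_mono[OF C(1) C_subset(3)]] show ?thesis
        unfolding g subst_minor C(2-5)[THEN kill] unfolding minor_def .
    qed
  qed
  show "subst (\<lambda>v. var (id v)) g \<in> ideal_gen V (inner_minors P)"
    if g: "g \<in> (inner_minors P4 :: 'k mpoly set)" for g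
  proof -
    obtain i k j l where g: "g = minor p i k j l" and box: "inner_interval P4 (pt i j) (pt k l)"
      using g by (rule inner_minorsE)
    have "inner_interval P (pt i j) (pt k l)" using inner_interval_mono[OF box] by blast
    from inner_minor[OF this] show ?thesis unfolding g subst_minor by (simp add: minor_def)
  qed
qed

end

section \<open>The filtration by the corner variables\<close>

lemma var_notin_inner_minors:
  "var v \<notin> ideal_gen W (inner_minors S :: 'k::field mpoly set)"
proof
  assume "var v \<in> ideal_gen W (inner_minors S :: 'k mpoly set)"
  then have "2 \<le> total_degree (Poly_Mapping.single v 1)"
  proof (rule ideal_gen_degree_ge)
    fix g m assume "g \<in> (inner_minors S :: 'k mpoly set)" "m \<in> Poly_Mapping.keys g"
    then show "2 \<le> total_degree m"
      using inner_minors_homogeneous[of g S] by (auto simp: homogeneous_part_iff)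
  qed (simp add: var_def)
  then show False by (simp add: total_degree_def)
qed

lemma homogeneous_inner_minors: "homogeneous_set (vertices S) (inner_minors S)"
  unfolding homogeneous_set_def using inner_minors_homogeneous by blast

lemma homogeneous_set_insert_var:
  "homogeneous_set V G \<Longrightarrow> v \<in> V \<Longrightarrow> homogeneous_set V (insert (var v) G)"
  unfolding homogeneous_set_def using homogeneous_var by blast

lemma HP_free_variables:
  assumes "finite (vertices S)" "finite F" "F \<inter> vertices S = {}"
  shows "hilbert_series (vertices S \<union> F) (ideal_gen (vertices S \<union> F) (inner_minors S :: 'k::field mpoly set))
    = HP TYPE('k) S / (1 - fps_X) ^ card F"
  unfolding HP_eq_hilbert_series[OF assms(1)]
  by (rule hilbert_series_free[OF assms(1) homogeneous_inner_minors assms(2,3)])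

context LC_configuration
begin

lemma card_free_row: "finite free_row \<and> card free_row = r - 2"
proof -
  have F: "free_row = (\<lambda>x. pt x yw) ` {2..int r - 1}"
    by (auto simp: region_def)
  have "inj_on (\<lambda>x. pt x yw) {2..int r - 1}" by (auto simp: inj_on_def)
  then show ?thesis unfolding F by (simp add: card_image)
qed

lemma card_free_column: "finite free_column \<and> card free_column = s - 2"
proof -
  have F: "free_column = (\<lambda>y. pt xw y) ` {2..int s - 1}"
    by (auto simp: region_def)
  have "inj_on (\<lambda>y. pt xw y) {2..int s - 1}" by (auto simp: inj_on_def)
  then show ?thesis unfolding F by (simp add: card_image)
qed

lemma free_disjoint: "free_row \<inter> vertices P1 = {}" "free_column \<inter> vertices P2 = {}" "free_points \<inter> vertices C = {}" "free_row \<inter> free_column = {}"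
  "pt xw yw \<notin> free_row \<union> free_column"
proof -
  have w: "xw = 0 \<or> xw = 1" "yw = 0 \<or> yw = 1" using coord by auto
  have c1: "\<not> onC x yw" if "2 \<le> x" "x \<le> int r - 1" for x
    using onC_onL[of x yw] that w rs unfolding onL_def by linarith
  have c2: "\<not> onC xw y" if "2 \<le> y" "y \<le> int s - 1" for y
    using onC_onL[of xw y] that w rs unfolding onL_def by linarith
  have c3: "\<not> onC xw yw" using C_fixed_row[of xw yw] w by auto
  have 1: "v \<notin> vertices P1 \<and> v \<notin> vertices C \<and> v \<notin> free_column \<and> v \<noteq> pt xw yw" if "v \<in> free_row" for v
  proof -
    obtain x y where v: "v = pt x y" by (rule point_cases)
    have xy: "y = yw" "2 \<le> x" "x \<le> int r - 1" using that unfolding v by auto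
    then show ?thesis using c1[of x] w unfolding v mem_vertices_P1 onC_iff mem_region by auto
  qed
  have 2: "v \<notin> vertices P2 \<and> v \<notin> vertices C \<and> v \<noteq> pt xw yw" if "v \<in> free_column" for v
  proof -
    obtain x y where v: "v = pt x y" by (rule point_cases)
    have xy: "x = xw" "2 \<le> y" "y \<le> int s - 1" using that unfolding v by auto
    then show ?thesis using c2[of y] w unfolding v mem_vertices_P2 onC_iff mem_region by auto
  qed
  show "free_row \<inter> vertices P1 = {}" "free_column \<inter> vertices P2 = {}" "free_points \<inter> vertices C = {}" "free_row \<inter> free_column = {}"
    "pt xw yw \<notin> free_row \<union> free_column"
    using 1 2 c3 onC_iff by blast+
qed

lemma card_free_points: "finite free_points \<and> card free_points = s + r - 3"
  using card_free_row card_free_column free_disjoint(4,5) rs by (simp add: card_Un_disjoint)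

lemma minors_P:
  "0 \<le> i \<Longrightarrow> i \<le> int r + 1 \<Longrightarrow> 0 \<le> k \<Longrightarrow> k \<le> int r + 1 \<Longrightarrow> minor p i k yu yw \<in> ideal_gen V (inner_minors P)"
  "0 \<le> j \<Longrightarrow> j \<le> int s + 1 \<Longrightarrow> 0 \<le> l \<Longrightarrow> l \<le> int s + 1 \<Longrightarrow> minor p xu xw j l \<in> ideal_gen V (inner_minors P)"
proof -
  have y: "yu = 0 \<or> yu = 1" "yw = 0 \<or> yw = 1" and x: "xu = 0 \<or> xu = 1" "xw = 0 \<or> xw = 1" using coord by auto
  have "cell (pt m 0) \<in> P" if "0 \<le> m" "m < int r + 1" for m using that by (simp add: P_iff)
  from row_minor[OF this y]
  show "0 \<le> i \<Longrightarrow> i \<le> int r + 1 \<Longrightarrow> 0 \<le> k \<Longrightarrow> k \<le> int r + 1 \<Longrightarrow> minor p i k yu yw \<in> ideal_gen V (inner_minors P)"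
    by blast
  have "cell (pt 0 n) \<in> P" if "0 \<le> n" "n < int s + 1" for n using that by (simp add: P_iff)
  from column_minor[OF this x]
  show "0 \<le> j \<Longrightarrow> j \<le> int s + 1 \<Longrightarrow> 0 \<le> l \<Longrightarrow> l \<le> int s + 1 \<Longrightarrow> minor p xu xw j l \<in> ideal_gen V (inner_minors P)"
    by blast
qed

text \<open>The order \<open>x\<^sub>1\<close>, \<open>x\<^sub>2\<close>, \<open>x\<^sub>3\<close>, \<open>x\<^sub>4\<close> of the corners ensures that the second term of each bar minor
  that is used contains a corner variable adjoined before.\<close>

theorem HP_eq:
  assumes "primeideal (polyomino_ideal P :: 'k::field mpoly set) (poly_ring V)"
  shows "HP TYPE('k) P = 1 / (1 - fps_X) * HP TYPE('k) P4
    + fps_X / (1 - fps_X) * (HP TYPE('k) P1 / (1 - fps_X) ^ (r - 2)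
     + HP TYPE('k) P2 / (1 - fps_X) ^ (s - 2) + HP TYPE('k) P3 / (1 - fps_X) ^ (s + r - 3))"
proof -
  let ?G = "inner_minors P :: 'k mpoly set"
  let ?I = "ideal_gen V ?G"
  have I: "polyomino_ideal P = ?I"
    unfolding polyomino_ideal_def by (rule genideal_eq_ideal_gen[OF inner_minors_polys])
  interpret I: primeideal ?I "poly_ring V" using assms unfolding I .
  have prime: "a \<in> ?I \<or> b \<in> ?I" if "a \<in> polys V" "b \<in> polys V" "a * b \<in> ?I" for a b
    using I.I_prime[OF that(1,2)] that(3) by simp
  have finV: "finite V" using finite_vertices by blast
  define x1 x2 x3 x4 where x: "x1 = pt xu yu" "x2 = pt xw yu" "x3 = pt xu yw" "x4 = pt xw yw"
  have uw: "xu = 0 \<or> xu = 1" "xw = 0 \<or> xw = 1" "yu = 0 \<or> yu = 1" "yw = 0 \<or> yw = 1" "xu \<noteq> xw" "yu \<noteq> yw"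
    using coord by auto
  have xV: "x1 \<in> V" "x2 \<in> V" "x3 \<in> V" "x4 \<in> V"
    using uw unfolding x by (auto simp: mem_V onL_def)
  let ?G1 = "insert (var x1) ?G"
  let ?G2 = "insert (var x2) ?G1"
  let ?G3 = "insert (var x3) ?G2"
  let ?G4 = "insert (var x4) ?G3"
  let ?H = "\<lambda>G :: 'k mpoly set. hilbert_series V (ideal_gen V G)"
  have hom: "homogeneous_set V ?G" by (rule homogeneous_inner_minors)
  note hom1 = homogeneous_set_insert_var[OF hom xV(1)]
  note hom2 = homogeneous_set_insert_var[OF hom1 xV(2)]
  note hom3 = homogeneous_set_insert_var[OF hom2 xV(3)]
  interpret r1: variable_retraction V "vertices P1 \<union> free_row" unattached_row \<sigma>_row \<tau>_row ?G "inner_minors P1"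
    by (rule retraction_P1)
  interpret r2: variable_retraction V "vertices P2 \<union> free_column" unattached_column \<sigma>_column \<tau>_column ?G "inner_minors P2"
    by (rule retraction_P2)
  interpret r3: variable_retraction V "vertices P3 \<union> free_points" "unattached_row \<union> unattached_column" id id ?G "inner_minors P3"
    by (rule retraction_P3)
  interpret r4: variable_retraction V "vertices P4" corner_points id id ?G "inner_minors P4"
    by (rule retraction_P4)
  have inD: "x1 \<in> unattached_row" "x1 \<in> unattached_column" "x2 \<in> unattached_row" "x3 \<in> unattached_column" "x2 \<notin> unattached_column" "x3 \<notin> unattached_row" "x4 \<notin> unattached_row" "x4 \<notin> unattached_column"
    using uw unfolding x by auto
  have row_rel: "var (pt i yu) * var (pt k yw) = minor p i k yu yw + var (pt i yw) * (var (pt k yu) :: 'k mpoly)" for i k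
    by (simp add: minor_def)
  have col_rel: "var (pt xu j) * var (pt xw l) = minor p xu xw j l + var (pt xu l) * (var (pt xw j) :: 'k mpoly)" for j l
    by (simp add: minor_def)

  have colon1: "?H ?G = fps_X * ?H ?G + ?H ?G1"
  proof (rule hilbert_series_colon[OF finV hom xV(1)])
    fix f :: "'k mpoly" assume f: "f \<in> polys V"
    show "f \<in> ?I \<longleftrightarrow> var x1 * f \<in> ?I"
    proof
      show "var x1 * f \<in> ?I" if "f \<in> ?I" using that xV(1) by (intro ideal_gen_mult) simp_all
      show "f \<in> ?I" if "var x1 * f \<in> ?I"
        using prime[OF _ f that] xV(1) by (simp add: var_notin_inner_minors)
    qed
  qed

  have colon2: "?H ?G1 = fps_X * hilbert_series V r2.preimage_ideal + ?H ?G2"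
  proof (rule hilbert_series_colon[OF finV hom1 xV(2)], rule r2.colon_preimage_ideal[OF prime xV(2)])
    fix d assume d: "d \<in> unattached_column"
    obtain a y where "d = pt a y" by (rule point_cases)
    then have d: "d = pt xu y" "0 \<le> y" "y \<le> int s + 1" using d by auto
    \<comment> \<open>Modulo the minors of the vertical bar, \<open>x\<^sub>2 d\<close> is a multiple of \<open>x\<^sub>1\<close>.\<close>
    have "minor p xu xw y yu \<in> ideal_gen V ?G1"
      using d uw by (intro subsetD[OF ideal_gen_mono minors_P(2)]) auto
    moreover have "var (pt xw y) * var x1 \<in> ideal_gen V ?G1"
      using d uw by (intro ideal_gen_mult ideal_gen_base) (auto simp: mem_V onL_def)
    ultimately have "minor p xu xw y yu + var (pt xw y) * var x1 \<in> ideal_gen V ?G1" by (rule ideal_gen_add)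
    then show "var x2 * var d \<in> ideal_gen V ?G1"
      using col_rel[of y yu] by (simp add: d x mult.commute)
  qed (use inD in \<open>auto simp: var_notin_inner_minors\<close>)

  have colon3: "?H ?G2 = fps_X * hilbert_series V r1.preimage_ideal + ?H ?G3"
  proof (rule hilbert_series_colon[OF finV hom2 xV(3)], rule r1.colon_preimage_ideal[OF prime xV(3)])
    fix d assume d: "d \<in> unattached_row"
    obtain i b where "d = pt i b" by (rule point_cases)
    then have d: "d = pt i yu" "0 \<le> i" "i \<le> int r + 1" using d by auto
    \<comment> \<open>Modulo the minors of the horizontal bar, \<open>x\<^sub>3 d\<close> is a multiple of \<open>x\<^sub>1\<close>.\<close>
    have "minor p i xu yu yw \<in> ideal_gen V ?G2"
      using d uw by (intro subsetD[OF ideal_gen_mono minors_P(1)]) auto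
    moreover have "var (pt i yw) * var x1 \<in> ideal_gen V ?G2"
      using d uw by (intro ideal_gen_mult ideal_gen_base) (auto simp: mem_V onL_def)
    ultimately have "minor p i xu yu yw + var (pt i yw) * var x1 \<in> ideal_gen V ?G2" by (rule ideal_gen_add)
    then show "var x3 * var d \<in> ideal_gen V ?G2"
      using row_rel[of i xu] by (simp add: d x mult.commute)
  qed (use inD in \<open>auto simp: var_notin_inner_minors\<close>)

  have colon4: "?H ?G3 = fps_X * hilbert_series V r3.preimage_ideal + ?H ?G4"
  proof (rule hilbert_series_colon[OF finV hom3 xV(4)], rule r3.colon_preimage_ideal[OF prime xV(4)])
    fix d assume d: "d \<in> unattached_row \<union> unattached_column"
    obtain i j where d': "d = pt i j" by (rule point_cases)
    from d consider "j = yu" "0 \<le> i" "i \<le> int r + 1" | "i = xu" "0 \<le> j" "j \<le> int s + 1"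
      unfolding d' by auto
    \<comment> \<open>A bar minor turns \<open>x\<^sub>4 d\<close> into a multiple of \<open>x\<^sub>2\<close> or of \<open>x\<^sub>3\<close>.\<close>
    then show "var x4 * var d \<in> ideal_gen V ?G3"
    proof cases
      case 1
      have "minor p i xw yu yw \<in> ideal_gen V ?G3"
        using 1 uw by (intro subsetD[OF ideal_gen_mono minors_P(1)]) auto
      moreover have "var (pt i yw) * var x2 \<in> ideal_gen V ?G3"
        using 1 uw by (intro ideal_gen_mult ideal_gen_base) (auto simp: mem_V onL_def)
      ultimately have "minor p i xw yu yw + var (pt i yw) * var x2 \<in> ideal_gen V ?G3" by (rule ideal_gen_add)
      then show ?thesis using row_rel[of i xw] 1 by (simp add: d' x mult.commute)
    next
      case 2
      have "minor p xu xw j yw \<in> ideal_gen V ?G3"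
        using 2 uw by (intro subsetD[OF ideal_gen_mono minors_P(2)]) auto
      moreover have "var (pt xw j) * var x3 \<in> ideal_gen V ?G3"
        using 2 uw by (intro ideal_gen_mult ideal_gen_base) (auto simp: mem_V onL_def)
      ultimately have "minor p xu xw j yw + var (pt xw j) * var x3 \<in> ideal_gen V ?G3" by (rule ideal_gen_add)
      then show ?thesis using col_rel[of j yw] 2 by (simp add: d' x mult.commute)
    qed
  qed (use inD in \<open>auto simp: var_notin_inner_minors\<close>)

  have "corner_points = {x1, x2, x3, x4}"
  proof -
    have "corner_points = {pt 0 0, pt 0 1, pt 1 0, pt 1 1}" by (auto simp: region_def)
    then show ?thesis using coord unfolding x by auto
  qed
  then have "?G4 = ?G \<union> var ` corner_points" by auto
  then have H4: "?H ?G4 = HP TYPE('k) P4"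
    using r4.hilbert_series_preimage_ideal HP_eq_hilbert_series[of P4, where 'k = 'k] finite_vertices[of P4] by auto
  have H1: "hilbert_series V r1.preimage_ideal = HP TYPE('k) P1 / (1 - fps_X) ^ (r - 2)"
    using HP_free_variables[of P1 free_row, where 'k = 'k] finite_vertices[of P1] card_free_row free_disjoint(1)
    by (simp add: r1.hilbert_series_preimage_ideal del: mem_region)
  have H2: "hilbert_series V r2.preimage_ideal = HP TYPE('k) P2 / (1 - fps_X) ^ (s - 2)"
    using HP_free_variables[of P2 free_column, where 'k = 'k] finite_vertices[of P2] card_free_column free_disjoint(2)
    by (simp add: r2.hilbert_series_preimage_ideal)
  have H3: "hilbert_series V r3.preimage_ideal = HP TYPE('k) P3 / (1 - fps_X) ^ (s + r - 3)"
  proof -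
    have "finite (vertices P3)" "free_points \<inter> vertices P3 = {}"
      using finite_vertices[of P3] free_disjoint(3) P3_eq by auto
    from HP_free_variables[OF this(1) _ this(2), where 'k = 'k] show ?thesis
      using card_free_points r3.hilbert_series_preimage_ideal by metis
  qed
  let ?S = "HP TYPE('k) P1 / (1 - fps_X) ^ (r - 2) + HP TYPE('k) P2 / (1 - fps_X) ^ (s - 2)
    + HP TYPE('k) P3 / (1 - fps_X) ^ (s + r - 3)"
  have "HP TYPE('k) P = ?H ?G" by (rule HP_eq_hilbert_series[OF finV])
  moreover have "?H ?G = fps_X * ?H ?G + (HP TYPE('k) P4 + fps_X * ?S)"
    using colon1 colon2 colon3 colon4 H1 H2 H3 H4 by (simp add: algebra_simps)
  ultimately have "HP TYPE('k) P * (1 - fps_X) = HP TYPE('k) P4 + fps_X * ?S"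
    by (simp add: algebra_simps)
  then have "HP TYPE('k) P * (1 - fps_X) * inverse (1 - fps_X) = (HP TYPE('k) P4 + fps_X * ?S) * inverse (1 - fps_X)"
    by simp
  moreover have "(1 - fps_X) * inverse (1 - fps_X :: rat fps) = 1"
    by (rule inverse_mult_eq_1') simp
  ultimately have "HP TYPE('k) P = (HP TYPE('k) P4 + fps_X * ?S) * inverse (1 - fps_X)"
    by (simp add: mult.assoc)
  also have "\<dots> = 1 * inverse (1 - fps_X) * HP TYPE('k) P4 + fps_X * inverse (1 - fps_X) * ?S"
  proof -
    have "(a + fps_X * b) * u = 1 * u * a + fps_X * u * b" for a b u :: "rat fps"
      by (simp add: algebra_simps)
    then show ?thesis .
  qed
  also have "1 * inverse (1 - fps_X) = 1 / (1 - fps_X :: rat fps)"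
    by (rule fps_divide_unit[symmetric]) simp
  also have "fps_X * inverse (1 - fps_X) = fps_X / (1 - fps_X :: rat fps)"
    by (rule fps_divide_unit[symmetric]) simp
  finally show ?thesis .
qed

end

theorem theorem3p8:
  fixes p :: point and r s :: nat and C P :: cells
  assumes "LC_polyomino p r s C P"
    and "primeideal (polyomino_ideal P :: 'k::field mpoly set) (poly_ring (vertices P))"
  shows "HP TYPE('k) P =
      1 / (1 - fps_X) * HP TYPE('k) (P - {cellA p 0, cellA p 1, cellB p 1})
    + fps_X / (1 - fps_X) *
      (HP TYPE('k) (P - row_cells p r) / (1 - fps_X) ^ (r - 2)
     + HP TYPE('k) (P - column_cells p s) / (1 - fps_X) ^ (s - 2)
     + HP TYPE('k) (P - (row_cells p r \<union> column_cells p s)) / (1 - fps_X) ^ (s + r - 3))"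
proof -
  note conj = assms(1)[unfolded LC_polyomino_def]
  note LC = conj[THEN conjunct1] conj[THEN conjunct2, THEN conjunct1]
    conj[THEN conjunct2, THEN conjunct2, THEN conjunct1]
  note conj' = conj[THEN conjunct2, THEN conjunct2, THEN conjunct2]
  note LC' = conj'[THEN conjunct1] conj'[THEN conjunct2, THEN conjunct1]
    conj'[THEN conjunct2, THEN conjunct2, THEN conjunct1]
  note attach = conj'[THEN conjunct2, THEN conjunct2, THEN conjunct2]
  have pts: "pt_a p (s - 1) = p + (1, int s)" "pt_a p s = p + (1, int s + 1)"
    "pt_d p (s - 1) = p + (0, int s)" "pt_d p s = p + (0, int s + 1)"
    "pt_b p (r - 1) = p + (int r, 1)" "pt_b p r = p + (int r + 1, 1)"
    "pt_c p (r - 1) = p + (int r, 0)" "pt_c p r = p + (int r + 1, 0)"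
    using LC(1,2) by (auto simp: pt_a_def pt_b_def pt_c_def pt_d_def of_nat_diff)
  have "\<exists>xw\<in>{0, 1}. \<exists>yw\<in>{0, 1}. vertices (cells_L p r s) \<inter> vertices C =
      {p + (xw, int s), p + (xw, int s + 1), p + (int r, yw), p + (int r + 1, yw)}"
  proof -
    have "\<exists>xw\<in>{0, 1}. \<exists>yw\<in>{0, 1}. A = {p + (xw, int s), p + (xw, int s + 1), p + (int r, yw), p + (int r + 1, yw)}"
      if "A \<in> {{p + (1, int s), p + (1, int s + 1), p + (int r, 1), p + (int r + 1, 1)},
        {p + (1, int s), p + (1, int s + 1), p + (int r, 0), p + (int r + 1, 0)},
        {p + (0, int s), p + (0, int s + 1), p + (int r, 1), p + (int r + 1, 1)},
        {p + (0, int s), p + (0, int s + 1), p + (int r, 0), p + (int r + 1, 0)}}" for A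
      using that unfolding insert_iff empty_iff bex_simps by metis
    from this[OF attach[unfolded pts]] show ?thesis .
  qed
  then obtain xw yw where w: "xw \<in> {0, 1}" "yw \<in> {0, 1}" "vertices (cells_L p r s) \<inter> vertices C =
      {p + (xw, int s), p + (xw, int s + 1), p + (int r, yw), p + (int r + 1, yw)}"
    by blast
  interpret LC_configuration p r s C P "1 - xw" xw "1 - yw" yw
    using LC LC' w by unfold_locales (auto simp: polyomino_def)
  show ?thesis by (rule HP_eq[OF assms(2)])
qed

end
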